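(* Let $n\ge2$. The function $\mathrm M_{\mathrm{Lag}}(A)$ is a polynomial of degree $2^n$ on $\mathrm{Sym}^2_{\mathbb R}(\mathbb C^n)$. In fact, after setting $\lambda_0\equiv\mu$, it is a symmetric polynomial of degree $2^{n-1}$ in the variables $(\lambda_0^2,\lambda_1^2,\dots,\lambda_n^2)$.
   Context: $\mathrm{Sym}^2_{\mathbb R}(\mathbb C^n)$ is the space of real symmetric endomorphisms of $\mathbb C^n=(\mathbb R^{2n},J)$. For $A\in \mathrm{Sym}^2_{\mathbb R}(\mathbb C^n)$ let $\mu=\frac12\mathrm{tr}A$ (real trace) and let $A^{\mathrm{skew}}=\frac12(A+JAJ)$, the skew-hermitian part of $A$. It anticommutes with $J$, so its $2n$ eigenvalues are $\pm\lambda_1,\dots,\pm\lambda_n$, with $\lambda_1,\dots,\lambda_n\ge0$. The Lagrangian Monge-Ampère operator $\mathrm M_{\mathrm{Lag}}:\mathrm{Sym}^2_{\mathbb R}(\mathbb C^n)\to\mathbb R$ is $$\mathrm M_{\mathrm{Lag}}(A)=\prod_{\pm}(\mu\pm\lambda_1\pm\cdots\pm\lambda_n),$$ the product being over all $2^n$ choices of signs. (Here $\lambda_1^2,\dots,\lambda_n^2$ are the eigenvalues of $(A^{\mathrm{skew}})^2$, each occurring with multiplicity 2.) *)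

theory Defs
  imports "HOL-Analysis.Analysis" "HOL-Library.Poly_Mapping"
begin

text \<open>
  A monomial is a finitely supported exponent function, a polynomial a finitely supported
  family of coefficients of monomials; the ring structure is the convolution product of
  \<^theory>\<open>HOL-Library.Poly_Mapping\<close>.
\<close>

type_synonym 'v rpoly = "('v \<Rightarrow>\<^sub>0 nat) \<Rightarrow>\<^sub>0 real"

definition monom_degree :: "('v \<Rightarrow>\<^sub>0 nat) \<Rightarrow> nat" where
  "monom_degree m = (\<Sum>v\<in>Poly_Mapping.keys m. Poly_Mapping.lookup m v)"

text \<open>The zero polynomial gets degree 0.\<close>

definition total_degree :: "'v rpoly \<Rightarrow> nat" where
  "total_degree p = Max (insert 0 (monom_degree ` Poly_Mapping.keys p))"

definition poly_vars :: "'v rpoly \<Rightarrow> 'v set" where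
  "poly_vars p = (\<Union>m\<in>Poly_Mapping.keys p. Poly_Mapping.keys m)"

definition poly_eval :: "'v rpoly \<Rightarrow> ('v \<Rightarrow> real) \<Rightarrow> real" where
  "poly_eval p x =
    (\<Sum>m\<in>Poly_Mapping.keys p. Poly_Mapping.lookup p m *
       (\<Prod>v\<in>Poly_Mapping.keys m. x v ^ Poly_Mapping.lookup m v))"

text \<open>Here \<open>Poly_Mapping.map_key \<pi> m\<close> is the monomial with exponents \<open>m \<circ> \<pi>\<close>.\<close>

definition symmetric_poly_in :: "'v set \<Rightarrow> 'v rpoly \<Rightarrow> bool" where
  "symmetric_poly_in I p \<longleftrightarrow> poly_vars p \<subseteq> I \<and>
    (\<forall>\<pi>. \<pi> permutes I \<longrightarrow>
      (\<forall>m. Poly_Mapping.lookup p (Poly_Mapping.map_key \<pi> m) = Poly_Mapping.lookup p m))"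

text \<open>
  A function on a finite-dimensional subspace \<open>V\<close> is a polynomial of degree \<open>d\<close> if it is one in
  the linear coordinates given by a basis \<open>B\<close> of \<open>V\<close>; the variables are the elements of \<open>B\<close>.
  Neither the property nor the degree depends on the basis. Since the coordinates are linearly
  independent and \<open>\<real>\<close> is infinite, the function determines \<open>p\<close>, so \<open>d\<close> is the exact degree.
\<close>

definition polynomial_of_degree_on :: "'a::real_vector set \<Rightarrow> ('a \<Rightarrow> real) \<Rightarrow> nat \<Rightarrow> bool" where
  "polynomial_of_degree_on V f d \<longleftrightarrow>
    (\<exists>B. finite B \<and> independent B \<and> span B = V \<and>
      (\<exists>p :: 'a rpoly. poly_vars p \<subseteq> B \<and> total_degree p = d \<and>
        (\<forall>v\<in>V. f v = poly_eval p (representation B v))))"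

text \<open>
  With its real inner product \<open>\<bullet>\<close> and multiplication by \<open>\<i>\<close>, \<open>complex ^ 'n\<close> is
  \<open>(\<real>\<^bsup>2n\<^esup>, J)\<close>, where \<open>n = CARD('n)\<close>. The endomorphisms \<open>\<Rightarrow>\<^sub>L\<close> are real linear
  (boundedness is automatic in finite dimension).
\<close>

lift_definition cplx_J :: "(complex ^ 'n) \<Rightarrow>\<^sub>L (complex ^ 'n::finite)" is "\<lambda>x. \<i> *s x"
  by (rule linear_conv_bounded_linear[THEN iffD1], rule linearI)
     (simp_all add: vec_eq_iff scaleR_conv_of_real algebra_simps)

definition Sym2 :: "((complex ^ 'n) \<Rightarrow>\<^sub>L (complex ^ 'n::finite)) set" where
  "Sym2 = {A. \<forall>x y. blinfun_apply A x \<bullet> y = x \<bullet> blinfun_apply A y}"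

definition half_trace :: "((complex ^ 'n) \<Rightarrow>\<^sub>L (complex ^ 'n::finite)) \<Rightarrow> real" where
  "half_trace A = (1/2) * (\<Sum>b\<in>Basis. blinfun_apply A b \<bullet> b)"

definition skew_part ::
  "((complex ^ 'n) \<Rightarrow>\<^sub>L (complex ^ 'n::finite)) \<Rightarrow> ((complex ^ 'n) \<Rightarrow>\<^sub>L (complex ^ 'n))" where
  "skew_part A = (1/2) *\<^sub>R (A + (cplx_J o\<^sub>L A o\<^sub>L cplx_J))"

text \<open>
  \<open>l 1, \<dots>, l n \<ge> 0\<close> are such that \<open>\<plusminus>l 1, \<dots>, \<plusminus>l n\<close> are the \<open>2n\<close> eigenvalues of
  \<open>skew_part A\<close> with multiplicity: every real \<open>t\<close> occurs in that list exactly as often as the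
  real dimension of the \<open>t\<close>-eigenspace (so a zero \<open>l i\<close> counts twice for \<open>t = 0\<close>). For
  symmetric \<open>A\<close> the skew part is symmetric, so all its eigenvalues are real and geometric and
  algebraic multiplicities agree. Values of \<open>l\<close> outside \<open>{1..n}\<close> are irrelevant.
\<close>

definition skew_eigenvalues ::
  "((complex ^ 'n) \<Rightarrow>\<^sub>L (complex ^ 'n::finite)) \<Rightarrow> (nat \<Rightarrow> real) \<Rightarrow> bool" where
  "skew_eigenvalues A l \<longleftrightarrow>
    (\<forall>i\<in>{1..CARD('n)}. 0 \<le> l i) \<and>
    (\<forall>t. dim {v. blinfun_apply (skew_part A) v = t *\<^sub>R v} =
         card {i\<in>{1..CARD('n)}. l i = t} + card {i\<in>{1..CARD('n)}. - l i = t})"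

text \<open>
  For \<open>A \<in> Sym2\<close> such an \<open>l\<close> exists and is unique on \<open>{1..n}\<close> up to order, and the product is
  invariant under reordering, so the choice made by \<open>SOME\<close> does not matter.
\<close>

definition M_Lag :: "((complex ^ 'n) \<Rightarrow>\<^sub>L (complex ^ 'n::finite)) \<Rightarrow> real" where
  "M_Lag A =
    (let l = (SOME l. skew_eigenvalues A l)
     in \<Prod>s\<in>{1..CARD('n)} \<rightarrow>\<^sub>E {-1, 1}. half_trace A + (\<Sum>i\<in>{1..CARD('n)}. s i * l i))"

end

theory Submission
  imports Defs
begin

text \<open>
  The sign product \<open>F(x\<^sub>0, \<dots>, x\<^sub>n) = \<Prod>\<^sub>s (x\<^sub>0 + \<Sum>\<^sub>i s\<^sub>i x\<^sub>i)\<close> is even in each variable, and exchanging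
  \<open>x\<^sub>0\<close> with \<open>x\<^sub>j\<close> multiplies the factor at \<open>s\<close> by \<open>s\<^sub>j\<close> and permutes the factors, where \<open>\<Prod>\<^sub>s s\<^sub>j = 1\<close>
  because \<open>n \<ge> 2\<close>. Hence \<open>F\<close> is a symmetric polynomial in the squares of its variables.
  A symmetric polynomial in \<open>\<lambda>\<^sub>1\<^sup>2, \<dots>, \<lambda>\<^sub>n\<^sup>2\<close> is a polynomial in the power sums
  \<open>\<Sum>\<^sub>i \<lambda>\<^sub>i\<^bsup>2k\<^esup>\<close>, and these are half the traces of the even powers of the skew part, hence polynomial
  in the coordinates of \<open>A\<close>. Exact degrees come from homogeneity: whatever polynomial
  represents a nonzero function homogeneous of degree \<open>N\<close>, its component of degree \<open>N\<close> does so too.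
\<close>

subsection \<open>Polynomial functions\<close>

abbreviation keys where "keys \<equiv> Poly_Mapping.keys"
abbreviation lookup where "lookup \<equiv> Poly_Mapping.lookup"

definition monom_eval :: "('v \<Rightarrow>\<^sub>0 nat) \<Rightarrow> ('v \<Rightarrow> real) \<Rightarrow> real" where
  "monom_eval m x = (\<Prod>v\<in>keys m. x v ^ lookup m v)"

lemma monom_eval_superset:
  assumes "finite I" "keys m \<subseteq> I"
  shows "monom_eval m x = (\<Prod>v\<in>I. x v ^ lookup m v)"
  unfolding monom_eval_def
  by (rule prod.mono_neutral_left) (use assms in \<open>auto simp: in_keys_iff\<close>)

lemma monom_eval_add: "monom_eval (m + m') x = monom_eval m x * monom_eval m' x"
proof -
  have "finite (keys m \<union> keys m')" by simp
  then show ?thesis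
    using keys_add[of m m'] monom_eval_superset[of "keys m \<union> keys m'"]
    by (simp add: lookup_add power_add prod.distrib)
qed

lemma monom_eval_scale: "monom_eval m (\<lambda>v. t * x v) = t ^ monom_degree m * monom_eval m x"
  by (simp add: monom_eval_def monom_degree_def power_mult_distrib prod.distrib power_sum)

lemma poly_eval_superset:
  assumes "finite T" "keys p \<subseteq> T"
  shows "poly_eval p x = (\<Sum>m\<in>T. lookup p m * monom_eval m x)"
  unfolding poly_eval_def monom_eval_def
  by (rule sum.mono_neutral_left) (use assms in \<open>auto simp: in_keys_iff\<close>)

lemma poly_eval_add: "poly_eval (p + q) x = poly_eval p x + poly_eval q x"
proof -
  have "finite (keys p \<union> keys q)" by simp
  then show ?thesis
    using keys_add[of p q] poly_eval_superset[of "keys p \<union> keys q"]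
    by (simp add: lookup_add distrib_right sum.distrib)
qed

lemma poly_eval_zero [simp]: "poly_eval 0 x = 0"
  by (simp add: poly_eval_def)

lemma poly_eval_sum: "poly_eval (\<Sum>i\<in>I. p i) x = (\<Sum>i\<in>I. poly_eval (p i) x)"
  by (induction I rule: infinite_finite_induct) (simp_all add: poly_eval_add)

lemma poly_eval_single: "poly_eval (Poly_Mapping.single m c) x = c * monom_eval m x"
  using poly_eval_superset[of "{m}" "Poly_Mapping.single m c"] by simp

lemma poly_vars_subset_iff: "poly_vars p \<subseteq> B \<longleftrightarrow> (\<forall>m. lookup p m \<noteq> 0 \<longrightarrow> keys m \<subseteq> B)"
  unfolding poly_vars_def in_keys_iff[symmetric] by blast

lemma poly_vars_zero: "poly_vars 0 = {}"
  by (simp add: poly_vars_def)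

lemma poly_vars_add:
  assumes "poly_vars p \<subseteq> B" "poly_vars q \<subseteq> B"
  shows "poly_vars (p + q) \<subseteq> B"
  using assms keys_add[of p q] unfolding poly_vars_def by blast

lemma poly_vars_sum:
  assumes "\<And>i. i \<in> I \<Longrightarrow> poly_vars (p i) \<subseteq> B"
  shows "poly_vars (\<Sum>i\<in>I. p i) \<subseteq> B"
  using assms
  by (induction I rule: infinite_finite_induct)
     (simp_all add: poly_vars_add poly_vars_zero)

lemma poly_vars_single:
  assumes "keys m \<subseteq> B"
  shows "poly_vars (Poly_Mapping.single m c) \<subseteq> B"
  using assms by (auto simp: poly_vars_def split: if_splits)

text \<open>The parameter \<open>s\<close> is kept apart from its coordinates \<open>c s\<close>, so
  the same closure rules serve vectors with their squares as coordinates and endomorphisms with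
  coordinates in a basis.\<close>

definition polynomial_in ::
  "'s set \<Rightarrow> 'v set \<Rightarrow> ('s \<Rightarrow> 'v \<Rightarrow> real) \<Rightarrow> ('s \<Rightarrow> real) \<Rightarrow> bool" where
  "polynomial_in X B c h \<longleftrightarrow> (\<exists>p. poly_vars p \<subseteq> B \<and> (\<forall>s\<in>X. h s = poly_eval p (c s)))"

lemma polynomial_in_cong:
  assumes "\<And>s. s \<in> X \<Longrightarrow> h s = h' s"
  shows "polynomial_in X B c h \<longleftrightarrow> polynomial_in X B c h'"
  using assms by (simp add: polynomial_in_def)

lemma polynomial_in_const: "polynomial_in X B c (\<lambda>s. r)"
  unfolding polynomial_in_def
  by (rule exI[of _ "Poly_Mapping.single 0 r"])
     (auto simp: poly_vars_def poly_eval_single monom_eval_def split: if_splits)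

lemma polynomial_in_var: "v \<in> B \<Longrightarrow> polynomial_in X B c (\<lambda>s. c s v)"
  unfolding polynomial_in_def
  by (rule exI[of _ "Poly_Mapping.single (Poly_Mapping.single v 1) 1"])
     (auto simp: poly_vars_def poly_eval_single monom_eval_def split: if_splits)

lemma polynomial_in_add:
  assumes "polynomial_in X B c g" "polynomial_in X B c h"
  shows "polynomial_in X B c (\<lambda>s. g s + h s)"
proof -
  from assms obtain p q where "poly_vars p \<subseteq> B" "\<forall>s\<in>X. g s = poly_eval p (c s)"
    and "poly_vars q \<subseteq> B" "\<forall>s\<in>X. h s = poly_eval q (c s)"
    unfolding polynomial_in_def by blast
  then show ?thesis
    unfolding polynomial_in_def
    by (intro exI[of _ "p + q"]) (simp add: poly_eval_add poly_vars_add)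
qed

lemma polynomial_in_mult:
  assumes "polynomial_in X B c g" "polynomial_in X B c h"
  shows "polynomial_in X B c (\<lambda>s. g s * h s)"
proof -
  from assms obtain p q where p: "poly_vars p \<subseteq> B" "\<forall>s\<in>X. g s = poly_eval p (c s)"
    and q: "poly_vars q \<subseteq> B" "\<forall>s\<in>X. h s = poly_eval q (c s)"
    unfolding polynomial_in_def by blast
  let ?r = "\<Sum>m\<in>keys p. \<Sum>m'\<in>keys q. Poly_Mapping.single (m + m') (lookup p m * lookup q m')"
  have "poly_eval ?r x = poly_eval p x * poly_eval q x" for x
    using poly_eval_superset[of "keys p" p] poly_eval_superset[of "keys q" q]
    by (simp add: poly_eval_sum poly_eval_single monom_eval_add sum_product algebra_simps)
  moreover have "poly_vars ?r \<subseteq> B"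
  proof (intro poly_vars_sum poly_vars_single)
    fix m m' assume "m \<in> keys p" "m' \<in> keys q"
    then have "keys m \<subseteq> B" "keys m' \<subseteq> B" using p(1) q(1) by (auto simp: poly_vars_def)
    then show "keys (m + m') \<subseteq> B" using keys_add[of m m'] by blast
  qed
  ultimately show ?thesis
    using p(2) q(2) unfolding polynomial_in_def by (intro exI[of _ ?r]) simp
qed

lemma polynomial_in_sum:
  assumes "\<And>i. i \<in> I \<Longrightarrow> polynomial_in X B c (h i)"
  shows "polynomial_in X B c (\<lambda>s. \<Sum>i\<in>I. h i s)"
  using assms
  by (induction I rule: infinite_finite_induct)
     (auto intro: polynomial_in_const polynomial_in_add)

lemma polynomial_in_prod:
  assumes "\<And>i. i \<in> I \<Longrightarrow> polynomial_in X B c (h i)"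
  shows "polynomial_in X B c (\<lambda>s. \<Prod>i\<in>I. h i s)"
  using assms
  by (induction I rule: infinite_finite_induct)
     (auto intro: polynomial_in_const polynomial_in_mult)

lemma polynomial_in_power:
  "polynomial_in X B c h \<Longrightarrow> polynomial_in X B c (\<lambda>s. h s ^ k)"
  by (induction k) (auto intro: polynomial_in_const polynomial_in_mult)

lemma polynomial_in_diff:
  assumes "polynomial_in X B c g" "polynomial_in X B c h"
  shows "polynomial_in X B c (\<lambda>s. g s - h s)"
  using polynomial_in_add[OF assms(1) polynomial_in_mult[OF polynomial_in_const[of _ _ _ "-1"] assms(2)]]
  by simp

section \<open>Homogeneous components and exact degrees\<close>

definition hom_component :: "nat \<Rightarrow> 'v rpoly \<Rightarrow> 'v rpoly" where
  "hom_component N p =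
     (\<Sum>m\<in>{m \<in> keys p. monom_degree m = N}. Poly_Mapping.single m (lookup p m))"

lemma lookup_hom_component:
  "lookup (hom_component N p) m = (if monom_degree m = N then lookup p m else 0)"
proof -
  have "lookup (hom_component N p) m =
      (\<Sum>m'\<in>{m \<in> keys p. monom_degree m = N}. if m' = m then lookup p m else 0)"
    unfolding hom_component_def lookup_sum
    by (rule sum.cong) (auto simp: lookup_single when_def)
  then show ?thesis by (auto simp: in_keys_iff)
qed

lemma poly_eval_hom_component:
  "poly_eval (hom_component N p) x =
     (\<Sum>m\<in>{m \<in> keys p. monom_degree m = N}. lookup p m * monom_eval m x)"
  by (simp add: hom_component_def poly_eval_sum poly_eval_single)

text \<open>Grouping the monomials by degree gives a univariate polynomial in \<open>t\<close>. Any
  upper bound \<open>K\<close> is allowed, so that the sum can be made to reach a prescribed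
  index.\<close>

lemma poly_eval_scale:
  assumes "total_degree p \<le> K"
  shows "poly_eval p (\<lambda>v. t * x v) = (\<Sum>k\<le>K. poly_eval (hom_component k p) x * t ^ k)"
proof -
  have deg: "monom_degree m \<le> K" if "m \<in> keys p" for m
    using assms that unfolding total_degree_def by simp
  have "poly_eval p (\<lambda>v. t * x v) =
      (\<Sum>m\<in>keys p. lookup p m * monom_eval m x * t ^ monom_degree m)"
    by (simp add: poly_eval_superset[of "keys p"] monom_eval_scale mult_ac)
  also have "\<dots> = (\<Sum>k\<le>K. \<Sum>m\<in>{m \<in> keys p. monom_degree m = k}.
      lookup p m * monom_eval m x * t ^ monom_degree m)"
    by (rule sum.group[symmetric]) (use deg in auto)
  also have "\<dots> = (\<Sum>k\<le>K. poly_eval (hom_component k p) x * t ^ k)"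
    by (simp add: poly_eval_hom_component sum_distrib_right)
  finally show ?thesis .
qed

text \<open>Both sides of the assumption are polynomials in \<open>t\<close> that agree for the
  infinitely many positive \<open>t\<close>, so their coefficients at \<open>t ^ N\<close>
  agree.\<close>

lemma poly_eval_hom_component_eq:
  assumes "\<And>t. 0 < t \<Longrightarrow> poly_eval p (\<lambda>v. t * x v) = t ^ N * poly_eval p x"
  shows "poly_eval (hom_component N p) x = poly_eval p x"
proof (rule ccontr)
  assume neq: "\<not> ?thesis"
  \<comment> \<open>The maximum keeps the index \<open>N\<close> within the sum even when it exceeds
    the degree of \<open>p\<close>.\<close>
  define K where "K = max N (total_degree p)"
  \<comment> \<open>\<open>a k\<close> is the coefficient of \<open>t ^ k\<close> in the difference
    of the two sides of the scaling law; \<open>neq\<close> makes \<open>a N\<close>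
    nonzero.\<close>
  define a where "a k = poly_eval (hom_component k p) x - (if k = N then poly_eval p x else 0)" for k
  have "(\<Sum>k\<le>K. a k * t ^ k) = 0" if "0 < t" for t
  proof -
    have "(\<Sum>k\<le>K. a k * t ^ k) = (\<Sum>k\<le>K. poly_eval (hom_component k p) x * t ^ k)
        - (\<Sum>k\<le>K. if k = N then poly_eval p x * t ^ k else 0)"
      unfolding sum_subtractf[symmetric]
      by (rule sum.cong) (auto simp: a_def algebra_simps)
    also have "\<dots> = poly_eval p (\<lambda>v. t * x v) - poly_eval p x * t ^ N"
      using poly_eval_scale[of p K t x] by (simp add: K_def)
    finally show ?thesis using assms[OF that] by simp
  qed
  then have "{0<..} \<subseteq> {t. (\<Sum>k\<le>K. a k * t ^ k) = 0}" by auto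
  moreover have "finite {t. (\<Sum>k\<le>K. a k * t ^ k) = 0}"
    unfolding polyfun_finite_roots
    using neq by (intro exI[of _ N]) (simp add: a_def K_def)
  ultimately show False
    using infinite_Ioi[of "0::real"] finite_subset by blast
qed

text \<open>The nonzero value excludes the zero polynomial, to which \<open>total_degree\<close>
  assigns 0.\<close>

lemma total_degree_homogeneous:
  assumes "\<And>m. lookup p m \<noteq> 0 \<Longrightarrow> monom_degree m = N" and "poly_eval p x \<noteq> 0"
  shows "total_degree p = N"
proof -
  have "keys p \<noteq> {}" using assms(2) by (auto simp: poly_eval_def)
  then obtain m where "m \<in> keys p" by blast
  moreover have "\<forall>m\<in>keys p. monom_degree m = N" using assms(1) by (simp add: in_keys_iff)
  ultimately have "monom_degree ` keys p = {N}" by force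
  then show ?thesis by (simp add: total_degree_def)
qed

text \<open>\<open>X\<close> carries no scaling of its own, so the point with scaled coordinates is
  supplied as \<open>s'\<close>: a multiple of an endomorphism, or \<open>sqrt t\<close> times a
  vector when the coordinates are squares. A representing polynomial need not be homogeneous, but
  its component of degree \<open>N\<close> is, and it still represents \<open>h\<close>.\<close>

lemma polynomial_in_homogeneous:
  assumes "polynomial_in X B c h"
    and scale: "\<And>s t. s \<in> X \<Longrightarrow> 0 < t \<Longrightarrow>
      \<exists>s'\<in>X. c s' = (\<lambda>v. t * c s v) \<and> h s' = t ^ N * h s"
    and nz: "\<exists>s\<in>X. h s \<noteq> 0"
  obtains p where "poly_vars p \<subseteq> B" "total_degree p = N"
    "\<And>m. lookup p m \<noteq> 0 \<Longrightarrow> monom_degree m = N"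
    "\<And>s. s \<in> X \<Longrightarrow> h s = poly_eval p (c s)"
proof -
  obtain p where p: "poly_vars p \<subseteq> B" "\<And>s. s \<in> X \<Longrightarrow> h s = poly_eval p (c s)"
    using assms(1) unfolding polynomial_in_def by blast
  let ?p = "hom_component N p"
  have eval: "poly_eval ?p (c s) = h s" if "s \<in> X" for s
  proof -
    have "poly_eval p (\<lambda>v. t * c s v) = t ^ N * poly_eval p (c s)" if "0 < t" for t
      using scale[OF \<open>s \<in> X\<close> that] p(2) \<open>s \<in> X\<close> by metis
    then show ?thesis using poly_eval_hom_component_eq p(2)[OF that] by metis
  qed
  have hom: "monom_degree m = N" if "lookup ?p m \<noteq> 0" for m
    using that by (auto simp: lookup_hom_component split: if_splits)
  moreover have "poly_vars ?p \<subseteq> B"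
    using p(1) by (auto simp: poly_vars_subset_iff lookup_hom_component split: if_splits)
  moreover have "total_degree ?p = N"
    using nz eval hom total_degree_homogeneous by metis
  ultimately show thesis using that[of ?p] eval by metis
qed

section \<open>Renaming variables and symmetrizing polynomials\<close>

lemma keys_map_key_bij:
  assumes "bij \<pi>"
  shows "keys (Poly_Mapping.map_key \<pi> m) = inv \<pi> ` keys m"
  using assms by (simp add: keys_map_key bij_is_inj bij_vimage_eq_inv_image)

lemma lookup_map_key: "inj f \<Longrightarrow> lookup (Poly_Mapping.map_key f m) = lookup m \<circ> f"
  by (rule map_key.rep_eq)

lemma monom_eval_map_key:
  assumes "bij \<pi>"
  shows "monom_eval (Poly_Mapping.map_key \<pi> m) (x \<circ> \<pi>) = monom_eval m x"
proof -
  have "inj_on (inv \<pi>) (keys m)" "\<And>v. \<pi> (inv \<pi> v) = v"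
    using assms by (simp_all add: bij_is_surj inj_on_inv_into surj_f_inv_f)
  then show ?thesis
    using assms unfolding monom_eval_def keys_map_key_bij[OF assms]
    by (simp add: prod.reindex lookup_map_key bij_is_inj)
qed

lemma monom_degree_map_key:
  assumes "bij \<pi>"
  shows "monom_degree (Poly_Mapping.map_key \<pi> m) = monom_degree m"
proof -
  have "inj_on (inv \<pi>) (keys m)" "\<And>v. \<pi> (inv \<pi> v) = v"
    using assms by (simp_all add: bij_is_surj inj_on_inv_into surj_f_inv_f)
  then show ?thesis
    using assms unfolding monom_degree_def keys_map_key_bij[OF assms]
    by (simp add: sum.reindex lookup_map_key bij_is_inj)
qed

lemma map_key_inv:
  assumes "bij \<pi>"
  shows "Poly_Mapping.map_key (inv \<pi>) (Poly_Mapping.map_key \<pi> m) = m"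
    and "Poly_Mapping.map_key \<pi> (Poly_Mapping.map_key (inv \<pi>) m) = m"
proof -
  have "inj \<pi>" "inj (inv \<pi>)" "\<And>v. \<pi> (inv \<pi> v) = v" "\<And>v. inv \<pi> (\<pi> v) = v"
    using assms by (simp_all add: bij_is_inj bij_is_surj inj_on_inv_into surj_f_inv_f)
  then show "Poly_Mapping.map_key (inv \<pi>) (Poly_Mapping.map_key \<pi> m) = m"
    and "Poly_Mapping.map_key \<pi> (Poly_Mapping.map_key (inv \<pi>) m) = m"
    by (intro poly_mapping_eqI; simp add: lookup_map_key)+
qed

lemma inj_map_key:
  fixes \<pi> :: "'v \<Rightarrow> 'v"
  assumes "bij \<pi>"
  shows "inj (Poly_Mapping.map_key \<pi>)"
  by (rule inj_on_inverseI[of _ "Poly_Mapping.map_key (inv \<pi>)"]) (rule map_key_inv(1)[OF assms])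

text \<open>The coefficient at \<open>m\<close> is that of \<open>p\<close> at the renamed monomial,
  whose value at \<open>x \<circ> \<pi>\<close> is the value of \<open>m\<close> at
  \<open>x\<close>. Renaming is a bijection of monomials, so the two sums match.\<close>

lemma poly_eval_map_key:
  fixes \<pi> :: "'v \<Rightarrow> 'v"
  assumes "bij \<pi>"
  shows "poly_eval (Poly_Mapping.map_key (Poly_Mapping.map_key \<pi>) p) x = poly_eval p (x \<circ> \<pi>)"
proof -
  let ?k = "Poly_Mapping.map_key \<pi>"
  have ev: "poly_eval q y = (\<Sum>m\<in>keys q. lookup q m * monom_eval m y)" for q :: "'v rpoly" and y
    by (simp add: poly_eval_superset[of "keys q"])
  have inj: "inj ?k" by (rule inj_map_key[OF assms])
  have "poly_eval (Poly_Mapping.map_key ?k p) x =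
      (\<Sum>m\<in>?k -` keys p. lookup p (?k m) * monom_eval (?k m) (x \<circ> \<pi>))"
    unfolding ev by (simp add: keys_map_key[OF inj] lookup_map_key[OF inj] monom_eval_map_key[OF assms])
  also have "\<dots> = (\<Sum>m\<in>?k ` (?k -` keys p). lookup p m * monom_eval m (x \<circ> \<pi>))"
    by (subst sum.reindex[OF inj_on_subset[OF inj subset_UNIV]]) simp
  also have "?k ` (?k -` keys p) = keys p"
    by (rule surj_image_vimage_eq) (rule surjI, rule map_key_inv(2)[OF assms])
  finally show ?thesis unfolding ev .
qed

text \<open>Averaging gives symmetry of the coefficients themselves, as
  \<open>symmetric_poly_in\<close> demands, without appeal to the uniqueness of a polynomial with
  given values.\<close>

definition symmetrize :: "'v set \<Rightarrow> 'v rpoly \<Rightarrow> 'v rpoly" where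
  "symmetrize I p = Poly_Mapping.map ((*) (1 / card {\<pi>. \<pi> permutes I}))
     (\<Sum>\<pi>\<in>{\<pi>. \<pi> permutes I}. Poly_Mapping.map_key (Poly_Mapping.map_key \<pi>) p)"

lemma lookup_symmetrize:
  "lookup (symmetrize I p) m =
     (\<Sum>\<pi>\<in>{\<pi>. \<pi> permutes I}. lookup p (Poly_Mapping.map_key \<pi> m)) / card {\<pi>. \<pi> permutes I}"
  by (simp add: symmetrize_def map.rep_eq when_def lookup_sum lookup_map_key inj_map_key
      permutes_bij)

lemma symmetrize_nonzero:
  assumes "lookup (symmetrize I p) m \<noteq> 0"
  obtains \<pi> where "\<pi> permutes I" "lookup p (Poly_Mapping.map_key \<pi> m) \<noteq> 0"
proof -
  have "(\<Sum>\<pi>\<in>{\<pi>. \<pi> permutes I}. lookup p (Poly_Mapping.map_key \<pi> m)) \<noteq> 0"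
    using assms unfolding lookup_symmetrize by auto
  then show thesis using that by (metis (no_types, lifting) mem_Collect_eq sum.neutral)
qed

text \<open>Every summand takes the value of \<open>p\<close> at a permuted point, and all these
  values are \<open>a\<close>.\<close>

lemma poly_eval_symmetrize:
  assumes "finite I" and "\<And>\<pi>. \<pi> permutes I \<Longrightarrow> poly_eval p (x \<circ> \<pi>) = a"
  shows "poly_eval (symmetrize I p) x = a"
proof -
  let ?P = "{\<pi>. \<pi> permutes I}"
  let ?s = "\<Sum>\<pi>\<in>?P. Poly_Mapping.map_key (Poly_Mapping.map_key \<pi>) p"
  have lookup: "lookup (symmetrize I p) m = lookup ?s m / card ?P" for m
    by (simp add: symmetrize_def map.rep_eq when_def)
  then have "keys (symmetrize I p) \<subseteq> keys ?s"
    by (auto simp: in_keys_iff)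
  then have "poly_eval (symmetrize I p) x = poly_eval ?s x / card ?P"
    using poly_eval_superset[of "keys ?s" ?s x] poly_eval_superset[of "keys ?s" "symmetrize I p" x]
    by (simp add: lookup sum_divide_distrib)
  also have "poly_eval ?s x = card ?P * a"
    using assms(2) by (simp add: poly_eval_sum poly_eval_map_key permutes_bij)
  \<comment> \<open>The identity is a permutation, so the number divided by is positive.\<close>
  finally show ?thesis
    using finite_permutations[OF assms(1)] permutes_id[of I] by (auto simp: card_eq_0_iff simp del: permutes_id)
qed

text \<open>Renaming by \<open>\<sigma>\<close> only translates the permutation group over which the
  coefficients are averaged.\<close>

lemma symmetric_poly_in_symmetrize:
  assumes "poly_vars p \<subseteq> I"
  shows "symmetric_poly_in I (symmetrize I p)"
  unfolding symmetric_poly_in_def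
proof (intro conjI allI impI)
  show "poly_vars (symmetrize I p) \<subseteq> I"
    unfolding poly_vars_subset_iff
  proof (intro allI impI)
    fix m assume "lookup (symmetrize I p) m \<noteq> 0"
    then obtain \<pi> where \<pi>: "\<pi> permutes I" "lookup p (Poly_Mapping.map_key \<pi> m) \<noteq> 0"
      by (rule symmetrize_nonzero)
    then have "keys (Poly_Mapping.map_key \<pi> m) \<subseteq> I"
      using assms unfolding poly_vars_subset_iff by blast
    then have "inv \<pi> ` keys m \<subseteq> I"
      by (simp add: keys_map_key_bij permutes_bij[OF \<pi>(1)])
    then show "keys m \<subseteq> I"
      using permutes_in_image[OF permutes_inv[OF \<pi>(1)]] by blast
  qed
next
  fix \<sigma> m assume \<sigma>: "\<sigma> permutes I"
  have "(\<Sum>\<pi>\<in>{\<pi>. \<pi> permutes I}. lookup p (Poly_Mapping.map_key \<pi> (Poly_Mapping.map_key \<sigma> m))) =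
      (\<Sum>\<pi>\<in>{\<pi>. \<pi> permutes I}. lookup p (Poly_Mapping.map_key (\<sigma> \<circ> \<pi>) m))"
    using \<sigma> by (simp add: map_key_compose permutes_inj)
  also have "\<dots> = (\<Sum>\<pi>\<in>{\<pi>. \<pi> permutes I}. lookup p (Poly_Mapping.map_key \<pi> m))"
    by (rule setum_permutations_compose_left[OF \<sigma>, symmetric])
  finally show "lookup (symmetrize I p) (Poly_Mapping.map_key \<sigma> m) = lookup (symmetrize I p) m"
    by (simp add: lookup_symmetrize)
qed

section \<open>Sign changes and even polynomials\<close>

lemma card_signs: "finite I \<Longrightarrow> card (I \<rightarrow>\<^sub>E {-1, 1::real}) = 2 ^ card I"
  by (simp add: card_funcsetE numeral_2_eq_2)

text \<open>Averaging over all sign changes kills the monomials with an odd exponent.\<close>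

lemma even_polynomial_in_squares:
  assumes "finite I" and "polynomial_in UNIV I (\<lambda>x. x) h"
    and even: "\<And>x \<epsilon>. \<epsilon> \<in> I \<rightarrow>\<^sub>E {-1, 1} \<Longrightarrow> h (\<lambda>i. \<epsilon> i * x i) = h x"
  shows "polynomial_in UNIV I (\<lambda>x i. (x i)\<^sup>2) h"
proof -
  let ?E = "I \<rightarrow>\<^sub>E {-1, 1::real}"
  obtain p where p: "poly_vars p \<subseteq> I" and h: "\<And>x. h x = poly_eval p x"
    using assms(2) unfolding polynomial_in_def by auto
  have E: "finite ?E" "card ?E = 2 ^ card I"
    using assms(1) by (simp_all add: finite_PiE card_signs)
  have eq: "h x = (1 / 2 ^ card I) * (\<Sum>m\<in>keys p. lookup p m *
      (\<Prod>i\<in>I. if even (lookup m i) then 2 * ((x i)\<^sup>2) ^ (lookup m i div 2) else 0))" for x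
  proof -
    have "(\<Sum>\<epsilon>\<in>?E. h (\<lambda>i. \<epsilon> i * x i)) = 2 ^ card I * h x"
      using even E by simp
    also have "(\<Sum>\<epsilon>\<in>?E. h (\<lambda>i. \<epsilon> i * x i)) =
        (\<Sum>m\<in>keys p. lookup p m * (\<Sum>\<epsilon>\<in>?E. monom_eval m (\<lambda>i. \<epsilon> i * x i)))"
      by (simp add: h poly_eval_superset[of "keys p"] sum_distrib_left sum.swap[of _ ?E])
    also have "\<dots> = (\<Sum>m\<in>keys p. lookup p m *
      (\<Prod>i\<in>I. if even (lookup m i) then 2 * ((x i)\<^sup>2) ^ (lookup m i div 2) else 0))"
    proof (rule sum.cong[OF refl])
      fix m assume "m \<in> keys p"
      then have "keys m \<subseteq> I" using p by (auto simp: poly_vars_def)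
      then have "(\<Sum>\<epsilon>\<in>?E. monom_eval m (\<lambda>i. \<epsilon> i * x i)) =
          (\<Sum>\<epsilon>\<in>?E. \<Prod>i\<in>I. (\<epsilon> i * x i) ^ lookup m i)"
        by (simp add: monom_eval_superset[OF assms(1)])
      \<comment> \<open>A sum over sign vectors of a product over coordinates factors. The factor at
        \<open>i\<close> is twice the power of \<open>x i\<close> for an even exponent and 0 for an
        odd one.\<close>
      also have "\<dots> = (\<Prod>i\<in>I. \<Sum>e\<in>{-1, 1}. (e * x i) ^ lookup m i)"
        by (rule prod_sum_PiE[symmetric]) (use assms(1) in auto)
      also have "\<dots> = (\<Prod>i\<in>I. if even (lookup m i) then 2 * ((x i)\<^sup>2) ^ (lookup m i div 2) else 0)"
        by (rule prod.cong) (auto simp: power_mult_distrib simp flip: power_mult)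
      finally show "lookup p m * (\<Sum>\<epsilon>\<in>?E. monom_eval m (\<lambda>i. \<epsilon> i * x i)) = lookup p m *
        (\<Prod>i\<in>I. if even (lookup m i) then 2 * ((x i)\<^sup>2) ^ (lookup m i div 2) else 0)"
        by simp
    qed
    finally show ?thesis by simp
  qed
  have "polynomial_in UNIV I (\<lambda>x i. (x i)\<^sup>2)
      (\<lambda>x. if even k then 2 * ((x i)\<^sup>2) ^ (k div 2) else 0)" if "i \<in> I" for i and k :: nat
    using polynomial_in_mult[OF polynomial_in_const polynomial_in_power[OF polynomial_in_var]] that
    by (cases "even k") (simp_all add: polynomial_in_const)
  then show ?thesis
    unfolding polynomial_in_cong[of UNIV h, OF eq]
    by (intro polynomial_in_mult polynomial_in_sum polynomial_in_prod polynomial_in_const)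
qed

section \<open>Sums over injections as polynomials in power sums\<close>

definition injections :: "'a set \<Rightarrow> 'b set \<Rightarrow> ('a \<Rightarrow> 'b) set" where
  "injections K I = {\<sigma> \<in> K \<rightarrow>\<^sub>E I. inj_on \<sigma> K}"

lemma finite_injections: "finite K \<Longrightarrow> finite I \<Longrightarrow> finite (injections K I)"
  by (rule finite_subset[of _ "K \<rightarrow>\<^sub>E I"]) (auto simp: injections_def finite_PiE)

text \<open>
  The value at \<open>k\<close> ranges over all of \<open>I\<close>, corrected by the forbidden values \<open>\<sigma> j\<close>, for which the
  exponent of \<open>k\<close> merges into that of \<open>j\<close>.
\<close>

lemma sum_injections_insert:
  fixes z :: "'b \<Rightarrow> 'c::comm_ring_1"
  assumes "finite K" "finite I" "k \<notin> K"
  shows "(\<Sum>\<sigma>\<in>injections (insert k K) I. \<Prod>i\<in>insert k K. z (\<sigma> i) ^ a i) =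
    (\<Sum>i\<in>I. z i ^ a k) * (\<Sum>\<sigma>\<in>injections K I. \<Prod>i\<in>K. z (\<sigma> i) ^ a i) -
    (\<Sum>j\<in>K. \<Sum>\<sigma>\<in>injections K I. \<Prod>i\<in>K. z (\<sigma> i) ^ (a(j := a j + a k)) i)"
proof -
  \<comment> \<open>An injection on \<open>insert k K\<close> is an injection on \<open>K\<close>
    together with a value outside its image. Resetting the value at \<open>k\<close> to
    \<open>undefined\<close> keeps the restriction extensional.\<close>
  have "(\<Sum>\<sigma>\<in>injections (insert k K) I. \<Prod>i\<in>insert k K. z (\<sigma> i) ^ a i) =
      (\<Sum>(\<sigma>, j)\<in>Sigma (injections K I) (\<lambda>\<sigma>. I - \<sigma> ` K). z j ^ a k * (\<Prod>i\<in>K. z (\<sigma> i) ^ a i))"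
  proof (rule sum.reindex_bij_witness[where i = "\<lambda>(\<sigma>, j). \<sigma>(k := j)"
        and j = "\<lambda>\<sigma>. (\<sigma>(k := undefined), \<sigma> k)"])
    fix \<sigma> assume \<sigma>: "\<sigma> \<in> injections (insert k K) I"
    then show "(\<sigma>(k := undefined), \<sigma> k) \<in> Sigma (injections K I) (\<lambda>\<sigma>. I - \<sigma> ` K)"
      using assms(3) by (auto simp: injections_def PiE_iff extensional_def inj_on_def)
    have "(\<Prod>i\<in>K. z ((\<sigma>(k := undefined)) i) ^ a i) = (\<Prod>i\<in>K. z (\<sigma> i) ^ a i)"
      using assms(3) by (intro prod.cong) auto
    then show "(case (\<sigma>(k := undefined), \<sigma> k) of (\<sigma>, j) \<Rightarrow> z j ^ a k * (\<Prod>i\<in>K. z (\<sigma> i) ^ a i)) =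
        (\<Prod>i\<in>insert k K. z (\<sigma> i) ^ a i)"
      using assms by simp
  next
    fix b assume b: "b \<in> Sigma (injections K I) (\<lambda>\<sigma>. I - \<sigma> ` K)"
    then obtain \<sigma> j where [simp]: "b = (\<sigma>, j)" and \<sigma>: "\<sigma> \<in> injections K I" "j \<in> I" "j \<notin> \<sigma> ` K"
      by auto
    have "\<sigma>(k := j) \<in> insert k K \<rightarrow>\<^sub>E I"
      using \<sigma> by (intro PiE_fun_upd) (simp_all add: injections_def)
    moreover have "inj_on (\<sigma>(k := j)) (insert k K)"
      using \<sigma> assms(3) by (auto simp: injections_def inj_on_fun_updI)
    ultimately show "(case b of (\<sigma>, j) \<Rightarrow> \<sigma>(k := j)) \<in> injections (insert k K) I"
      by (simp add: injections_def)
    have "\<sigma> k = undefined"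
      using PiE_arb[of \<sigma> K "\<lambda>_. I" k] \<sigma>(1) assms(3) by (simp add: injections_def)
    then have "\<sigma>(k := undefined) = \<sigma>" by (rule fun_upd_idem)
    then show "((case b of (\<sigma>, j) \<Rightarrow> \<sigma>(k := j))(k := undefined),
        (case b of (\<sigma>, j) \<Rightarrow> \<sigma>(k := j)) k) = b" by simp
  qed auto
  also have "\<dots> = (\<Sum>\<sigma>\<in>injections K I. \<Sum>j\<in>I - \<sigma> ` K. z j ^ a k * (\<Prod>i\<in>K. z (\<sigma> i) ^ a i))"
    by (rule sum.Sigma[symmetric]) (use assms finite_injections in auto)
  also have "\<dots> = (\<Sum>\<sigma>\<in>injections K I. (\<Sum>i\<in>I. z i ^ a k) * (\<Prod>i\<in>K. z (\<sigma> i) ^ a i) -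
      (\<Sum>j\<in>K. \<Prod>i\<in>K. z (\<sigma> i) ^ (a(j := a j + a k)) i))"
  proof (rule sum.cong[OF refl])
    fix \<sigma> assume "\<sigma> \<in> injections K I"
    then have \<sigma>: "\<sigma> ` K \<subseteq> I" "inj_on \<sigma> K" by (auto simp: injections_def)
    \<comment> \<open>Injectivity lets the sum over the forbidden values be indexed by
      \<open>K\<close>.\<close>
    have "(\<Sum>j\<in>I - \<sigma> ` K. z j ^ a k) = (\<Sum>i\<in>I. z i ^ a k) - (\<Sum>j\<in>K. z (\<sigma> j) ^ a k)"
      using \<sigma> assms by (simp add: sum_diff sum.reindex)
    moreover have "(\<Prod>i\<in>K. z (\<sigma> i) ^ (a(j := a j + a k)) i) =
        z (\<sigma> j) ^ a k * (\<Prod>i\<in>K. z (\<sigma> i) ^ a i)" if "j \<in> K" for j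
    proof -
      have "(\<Prod>i\<in>K - {j}. z (\<sigma> i) ^ (a(j := a j + a k)) i) = (\<Prod>i\<in>K - {j}. z (\<sigma> i) ^ a i)"
        by (rule prod.cong) auto
      then show ?thesis
        using that assms(1) by (simp add: prod.remove[of K j] power_add mult_ac)
    qed
    ultimately show "(\<Sum>j\<in>I - \<sigma> ` K. z j ^ a k * (\<Prod>i\<in>K. z (\<sigma> i) ^ a i)) =
      (\<Sum>i\<in>I. z i ^ a k) * (\<Prod>i\<in>K. z (\<sigma> i) ^ a i) -
      (\<Sum>j\<in>K. \<Prod>i\<in>K. z (\<sigma> i) ^ (a(j := a j + a k)) i)"
      by (simp add: sum_distrib_right[symmetric] left_diff_distrib)
  qed
  also have "\<dots> = (\<Sum>i\<in>I. z i ^ a k) * (\<Sum>\<sigma>\<in>injections K I. \<Prod>i\<in>K. z (\<sigma> i) ^ a i) -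
    (\<Sum>j\<in>K. \<Sum>\<sigma>\<in>injections K I. \<Prod>i\<in>K. z (\<sigma> i) ^ (a(j := a j + a k)) i)"
    by (simp only: sum_subtractf sum_distrib_left sum.swap[of _ K])
  finally show ?thesis .
qed

text \<open>Splitting off an index \<open>k\<close> leaves a power sum and sums over fewer indices.
  The merged exponents force the induction to range over all \<open>a\<close>.\<close>

lemma polynomial_in_sum_injections:
  assumes "finite K" "finite I" and "\<And>k. polynomial_in X B c (\<lambda>s. \<Sum>i\<in>I. y s i ^ k)"
  shows "polynomial_in X B c (\<lambda>s. \<Sum>\<sigma>\<in>injections K I. \<Prod>i\<in>K. y s (\<sigma> i) ^ a i)"
  using assms(1)
proof (induction K arbitrary: a rule: finite_induct)
  case empty
  then show ?case by (simp add: polynomial_in_const)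
next
  case (insert k K)
  show ?case
    unfolding sum_injections_insert[OF insert.hyps(1) assms(2) insert.hyps(2)]
    by (intro polynomial_in_diff polynomial_in_mult polynomial_in_sum assms(3) insert.IH)
qed

text \<open>Averaging the formula for \<open>h\<close> over all \<open>\<sigma>\<close> turns every
  monomial of \<open>q\<close> into a sum over injections, which is polynomial in the power sums.
  Variable 0 is not permuted and enters through \<open>u\<close> alone.\<close>

lemma polynomial_in_power_sums:
  assumes q: "poly_vars q \<subseteq> {0..n::nat}"
    and u: "polynomial_in X B c u"
    and y: "\<And>k. polynomial_in X B c (\<lambda>s. \<Sum>i\<in>{1..n}. y s i ^ k)"
    and h: "\<And>s \<sigma>. s \<in> X \<Longrightarrow> \<sigma> \<in> injections {1..n} {1..n} \<Longrightarrow>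
      h s = poly_eval q (\<lambda>i. if i = 0 then u s else y s (\<sigma> i))"
  shows "polynomial_in X B c h"
proof -
  let ?S = "injections {1..n} {1..n}"
  \<comment> \<open>The identity, made extensional, shows that the average runs over a nonempty
    set.\<close>
  have "restrict id {1..n} \<in> ?S" by (auto simp: injections_def)
  then have card: "card ?S \<noteq> 0" using finite_injections[of "{1..n}" "{1..n}"] by auto
  have eq: "h s = (1 / card ?S) * (\<Sum>m\<in>keys q. lookup q m * u s ^ lookup m 0 *
      (\<Sum>\<sigma>\<in>?S. \<Prod>i\<in>{1..n}. y s (\<sigma> i) ^ lookup m i))" if "s \<in> X" for s
  proof -
    have mon: "monom_eval m (\<lambda>i. if i = 0 then u s else y s (\<sigma> i)) =
        u s ^ lookup m 0 * (\<Prod>i\<in>{1..n}. y s (\<sigma> i) ^ lookup m i)" if "m \<in> keys q" for m \<sigma>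
    proof -
      have "keys m \<subseteq> insert 0 {1..n}"
        using q that by (force simp: poly_vars_def)
      then show ?thesis
        using monom_eval_superset[of "insert 0 {1..n}" m] by simp
    qed
    have "card ?S * h s = (\<Sum>\<sigma>\<in>?S. h s)" by simp
    also have "\<dots> = (\<Sum>\<sigma>\<in>?S. poly_eval q (\<lambda>i. if i = 0 then u s else y s (\<sigma> i)))"
      by (rule sum.cong[OF refl h[OF that]])
    also have "\<dots> = (\<Sum>m\<in>keys q. lookup q m * u s ^ lookup m 0 *
        (\<Sum>\<sigma>\<in>?S. \<Prod>i\<in>{1..n}. y s (\<sigma> i) ^ lookup m i))"
      by (simp add: poly_eval_superset[of "keys q" q] mon sum_distrib_left mult_ac) (rule sum.swap)
    finally show ?thesis using card by (simp add: field_simps)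
  qed
  show ?thesis
    by (rule polynomial_in_cong[THEN iffD2], erule eq,
      intro polynomial_in_mult polynomial_in_sum polynomial_in_const polynomial_in_power u
        polynomial_in_sum_injections y) auto
qed

subsection \<open>The sign product\<close>

definition sign_prod :: "nat \<Rightarrow> (nat \<Rightarrow> real) \<Rightarrow> real" where
  "sign_prod n x = (\<Prod>s\<in>{1..n} \<rightarrow>\<^sub>E {-1, 1}. x 0 + (\<Sum>i\<in>{1..n}. s i * x i))"

lemma sign_prod_cong: "(\<And>i. i \<le> n \<Longrightarrow> x i = y i) \<Longrightarrow> sign_prod n x = sign_prod n y"
  by (simp add: sign_prod_def)

lemma signs_mult: "a \<in> {-1, 1} \<Longrightarrow> b \<in> {-1, 1} \<Longrightarrow> a * b \<in> {-1, 1::real}"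
  by auto

lemma PiE_signs_mem: "s \<in> I \<rightarrow>\<^sub>E {-1, 1::real} \<Longrightarrow> i \<in> I \<Longrightarrow> s i = -1 \<or> s i = 1"
  by (auto dest: PiE_mem)

lemma sign_prod_scale: "sign_prod n (\<lambda>i. t * x i) = t ^ (2 ^ n) * sign_prod n x"
proof -
  have "t * x 0 + (\<Sum>i\<in>{1..n}. s i * (t * x i)) = t * (x 0 + (\<Sum>i\<in>{1..n}. s i * x i))" for s
    by (simp add: algebra_simps sum_distrib_left)
  then show ?thesis
    by (simp add: sign_prod_def prod.distrib card_signs)
qed

text \<open>A sign at a positive index is absorbed by the sign vector. The sign of
  \<open>x 0\<close> is pulled out of every factor, and the number of factors is even.\<close>

lemma sign_prod_sign:
  assumes "1 \<le> n" and \<epsilon>: "\<epsilon> \<in> {0..n} \<rightarrow>\<^sub>E {-1, 1}"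
  shows "sign_prod n (\<lambda>i. \<epsilon> i * x i) = sign_prod n x"
proof -
  let ?S = "{1..n} \<rightarrow>\<^sub>E {-1, 1::real}"
  \<comment> \<open>The extra \<open>\<epsilon> 0\<close> compensates for the sign pulled out of the
    factor. All signs square to 1, so \<open>T\<close> is an involution and its own inverse in the
    reindexing.\<close>
  define T where "T s = (\<lambda>i\<in>{1..n}. \<epsilon> 0 * \<epsilon> i * s i)" for s :: "nat \<Rightarrow> real"
  have sq: "\<epsilon> i * \<epsilon> i = 1" if "i \<le> n" for i
    using PiE_signs_mem[OF \<epsilon>, of i] that by auto
  have sq': "\<epsilon> i * (\<epsilon> i * a) = a" if "i \<le> n" for i a
    using sq[OF that] by (simp flip: mult.assoc)
  have T: "T s \<in> ?S" "T (T s) = s" if s: "s \<in> ?S" for s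
  proof -
    show "T s \<in> ?S"
      unfolding T_def restrict_PiE_iff
    proof
      fix i assume "i \<in> {1..n}"
      then have "\<epsilon> 0 \<in> {-1, 1}" "\<epsilon> i \<in> {-1, 1}" "s i \<in> {-1, 1}"
        using PiE_mem[OF \<epsilon>] PiE_mem[OF s] by simp_all
      then show "\<epsilon> 0 * \<epsilon> i * s i \<in> {-1, 1}" by (intro signs_mult)
    qed
    show "T (T s) = s"
    proof
      fix i show "T (T s) i = s i"
      proof (cases "i \<in> {1..n}")
        case True
        have "\<epsilon> 0 * \<epsilon> i * (\<epsilon> 0 * \<epsilon> i * s i) = (\<epsilon> 0 * \<epsilon> 0) * ((\<epsilon> i * \<epsilon> i) * s i)"
          by (simp only: mult_ac)
        also have "\<dots> = s i" using True sq[of 0] sq[of i] by simp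
        finally show ?thesis using True by (simp only: T_def restrict_apply')
      next
        case False
        then show ?thesis using PiE_arb[OF s False] by (simp only: T_def restrict_apply if_False)
      qed
    qed
  qed
  have "\<epsilon> 0 * x 0 + (\<Sum>i\<in>{1..n}. s i * (\<epsilon> i * x i)) = \<epsilon> 0 * (x 0 + (\<Sum>i\<in>{1..n}. T s i * x i))"
    for s
    by (simp add: T_def distrib_left sum_distrib_left mult_ac sq')
  then have "sign_prod n (\<lambda>i. \<epsilon> i * x i) =
      \<epsilon> 0 ^ card ?S * (\<Prod>s\<in>?S. x 0 + (\<Sum>i\<in>{1..n}. T s i * x i))"
    by (simp add: sign_prod_def prod.distrib)
  also have "(\<Prod>s\<in>?S. x 0 + (\<Sum>i\<in>{1..n}. T s i * x i)) = sign_prod n x"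
    unfolding sign_prod_def
    by (rule prod.reindex_bij_witness[where i = T and j = T]) (use T in auto)
  also have "\<epsilon> 0 ^ card ?S = 1"
    using assms(1) PiE_signs_mem[OF \<epsilon>, of 0] by (auto simp: card_signs)
  finally show ?thesis by simp
qed

text \<open>The permutation is carried over to the sign vectors by reindexing the product with its
  inverse.\<close>

lemma sign_prod_permute_tail:
  assumes \<sigma>: "bij_betw \<sigma> {1..n} {1..n}" and "y 0 = x 0" "\<And>i. i \<in> {1..n} \<Longrightarrow> y i = x (\<sigma> i)"
  shows "sign_prod n y = sign_prod n x"
proof -
  \<comment> \<open>\<open>\<sigma>\<close> is known to be bijective on \<open>{1..n}\<close> only,
    hence the local inverse.\<close>
  define \<tau> where "\<tau> = inv_into {1..n} \<sigma>"
  have \<tau>: "\<tau> j \<in> {1..n}" "\<sigma> (\<tau> j) = j" if "j \<in> {1..n}" for j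
    using bij_betw_apply[OF bij_betw_inv_into[OF \<sigma>] that] bij_betw_inv_into_right[OF \<sigma> that]
    unfolding \<tau>_def by simp_all
  have \<sigma>': "\<sigma> i \<in> {1..n}" "\<tau> (\<sigma> i) = i" if "i \<in> {1..n}" for i
    using bij_betw_apply[OF \<sigma> that] bij_betw_inv_into_left[OF \<sigma> that]
    unfolding \<tau>_def by simp_all
  show ?thesis
    unfolding sign_prod_def
  proof (rule prod.reindex_bij_witness[where i = "\<lambda>s. \<lambda>i\<in>{1..n}. s (\<sigma> i)"
        and j = "\<lambda>s. \<lambda>j\<in>{1..n}. s (\<tau> j)"])
    fix s :: "nat \<Rightarrow> real" assume s: "s \<in> {1..n} \<rightarrow>\<^sub>E {-1, 1}"
    show "(\<lambda>i\<in>{1..n}. (\<lambda>j\<in>{1..n}. s (\<tau> j)) (\<sigma> i)) = s"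
    proof
      fix i show "(\<lambda>i\<in>{1..n}. (\<lambda>j\<in>{1..n}. s (\<tau> j)) (\<sigma> i)) i = s i"
        using \<sigma>'[of i] PiE_arb[OF s, of i]
        by (cases "i \<in> {1..n}") (simp_all only: restrict_apply if_True if_False simp_thms)
    qed
    show "(\<lambda>j\<in>{1..n}. (\<lambda>i\<in>{1..n}. s (\<sigma> i)) (\<tau> j)) = s"
    proof
      fix j show "(\<lambda>j\<in>{1..n}. (\<lambda>i\<in>{1..n}. s (\<sigma> i)) (\<tau> j)) j = s j"
        using \<tau>[of j] PiE_arb[OF s, of j]
        by (cases "j \<in> {1..n}") (simp_all only: restrict_apply if_True if_False simp_thms)
    qed
    show "(\<lambda>j\<in>{1..n}. s (\<tau> j)) \<in> {1..n} \<rightarrow>\<^sub>E {-1, 1}"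
      using PiE_mem[OF s] \<tau>(1) by (intro restrict_PiE_iff[THEN iffD2]) blast
    show "(\<lambda>i\<in>{1..n}. s (\<sigma> i)) \<in> {1..n} \<rightarrow>\<^sub>E {-1, 1}"
      using PiE_mem[OF s] \<sigma>'(1) by (intro restrict_PiE_iff[THEN iffD2]) blast
    have "(\<Sum>j\<in>{1..n}. s (\<tau> j) * x j) = (\<Sum>i\<in>{1..n}. s (\<tau> (\<sigma> i)) * x (\<sigma> i))"
      by (rule sum.reindex_bij_betw[OF \<sigma>, symmetric])
    then show "x 0 + (\<Sum>i\<in>{1..n}. (\<lambda>j\<in>{1..n}. s (\<tau> j)) i * x i) = y 0 + (\<Sum>i\<in>{1..n}. s i * y i)"
      using assms \<sigma>' by simp
  qed
qed

text \<open>Half of the sign vectors, \<open>2 ^ (n - 1)\<close> of them, have -1 at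
  \<open>j\<close>; this number is even because \<open>2 \<le> n\<close>.\<close>

lemma prod_signs_coordinate:
  fixes n j :: nat
  assumes "2 \<le> n" "j \<in> {1..n}"
  shows "(\<Prod>s\<in>{1..n} \<rightarrow>\<^sub>E {-1, 1}. s j) = (1 :: real)"
proof -
  let ?S = "{1..n} \<rightarrow>\<^sub>E {-1, 1::real}"
  have fin: "finite ?S" by (rule finite_PiE) simp_all
  have eq: "{s \<in> ?S. s j = -1} = (\<Pi>\<^sub>E i\<in>{1..n}. if i = j then {-1} else {-1, 1})" (is "_ = ?P")
  proof (rule set_eqI)
    fix s show "s \<in> {s \<in> ?S. s j = -1} \<longleftrightarrow> s \<in> ?P"
      using assms(2) by (auto simp: PiE_iff split: if_splits)
  qed
  have "card ?P = (\<Prod>i\<in>{1..n}. if i = j then 1 else 2)"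
    by (subst card_PiE) (auto intro: prod.cong)
  also have "\<dots> = 2 ^ (n - 1)"
    using assms(2) by (subst prod.remove[of _ j]) auto
  finally have card: "card {s \<in> ?S. s j = -1} = 2 ^ (n - 1)" using eq by simp
  have "(\<Prod>s\<in>?S. s j) = (\<Prod>s\<in>?S. if s j = -1 then -1 else 1)"
    by (rule prod.cong) (use PiE_signs_mem[of _ "{1..n}" j] assms(2) in auto)
  also have "\<dots> = (-1) ^ card {s \<in> ?S. s j = -1}"
    using fin by (simp add: prod.If_cases Int_def)
  also have "\<dots> = 1" using assms(1) card by simp
  finally show ?thesis .
qed

lemma sign_prod_transpose:
  assumes "2 \<le> n" "j \<in> {1..n}"
  shows "sign_prod n (x \<circ> Transposition.transpose 0 j) = sign_prod n x"
proof -
  let ?S = "{1..n} \<rightarrow>\<^sub>E {-1, 1::real}"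
  \<comment> \<open>The swapped factor is \<open>x j + s j * x 0 + R\<close> with \<open>R\<close>
    the remaining terms. Pulling out \<open>s j\<close> multiplies the signs in \<open>R\<close> by
    \<open>s j\<close> and puts \<open>s j\<close> in front of \<open>x j\<close>, so
    \<open>T\<close> fixes coordinate \<open>j\<close>.\<close>
  define T where "T s = (\<lambda>i\<in>{1..n}. if i = j then s j else s i * s j)" for s :: "nat \<Rightarrow> real"
  have sq: "s j * (s j * a) = a" if "s \<in> ?S" for s a
    using PiE_signs_mem[OF that assms(2)] by auto
  have T: "T s \<in> ?S" "T (T s) = s" if s: "s \<in> ?S" for s
  proof -
    show "T s \<in> ?S"
      unfolding T_def restrict_PiE_iff
    proof
      fix i assume "i \<in> {1..n}"
      then have "s i \<in> {-1, 1}" "s j \<in> {-1, 1}"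
        using PiE_mem[OF s] assms(2) by simp_all
      then show "(if i = j then s j else s i * s j) \<in> {-1, 1}" using signs_mult by presburger
    qed
    show "T (T s) = s"
    proof
      fix i show "T (T s) i = s i"
      proof (cases "i \<in> {1..n}")
        case True
        then show ?thesis
          using assms(2) sq[OF s, of "s i"] by (simp add: T_def mult.commute mult.left_commute)
      next
        case False
        then show ?thesis using PiE_arb[OF s False] by (simp only: T_def restrict_apply if_False)
      qed
    qed
  qed
  have factor: "(x \<circ> Transposition.transpose 0 j) 0 + (\<Sum>i\<in>{1..n}. s i * (x \<circ> Transposition.transpose 0 j) i) =
      s j * (x 0 + (\<Sum>i\<in>{1..n}. T s i * x i))" if s: "s \<in> ?S" for s
  proof -
    let ?R = "\<Sum>i\<in>{1..n} - {j}. s i * x i"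
    have rest: "(\<Sum>i\<in>{1..n} - {j}. s i * (x \<circ> Transposition.transpose 0 j) i) = ?R"
      by (rule sum.cong) (auto simp: transpose_apply_other)
    have "(\<Sum>i\<in>{1..n}. s i * (x \<circ> Transposition.transpose 0 j) i) = s j * x 0 + ?R"
      by (simp only: sum.remove[OF finite_atLeastAtMost assms(2)] rest) simp
    moreover have rest': "(\<Sum>i\<in>{1..n} - {j}. T s i * x i) = s j * ?R"
      unfolding sum_distrib_left by (rule sum.cong) (auto simp: T_def)
    have "(\<Sum>i\<in>{1..n}. T s i * x i) = s j * x j + s j * ?R"
      using assms(2) by (simp only: sum.remove[OF finite_atLeastAtMost assms(2)] rest') (simp add: T_def)
    ultimately show ?thesis
      using sq[OF s, of "x j"] sq[OF s, of ?R] by (simp only: distrib_left) simp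
  qed
  have "sign_prod n (x \<circ> Transposition.transpose 0 j) =
      (\<Prod>s\<in>?S. s j) * (\<Prod>s\<in>?S. x 0 + (\<Sum>i\<in>{1..n}. T s i * x i))"
    unfolding sign_prod_def prod.distrib[symmetric] by (rule prod.cong[OF refl factor])
  also have "(\<Prod>s\<in>?S. x 0 + (\<Sum>i\<in>{1..n}. T s i * x i)) = sign_prod n x"
    unfolding sign_prod_def
    by (rule prod.reindex_bij_witness[where i = T and j = T]) (use T in auto)
  finally show ?thesis by (simp only: prod_signs_coordinate[OF assms] mult_1_left)
qed

text \<open>A permutation of \<open>{0..n}\<close> is composed of a transposition involving 0 and a
  permutation fixing 0, and each kind preserves the product.\<close>

lemma sign_prod_permute:
  assumes "2 \<le> n" and \<pi>: "\<pi> permutes {0..n}"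
  shows "sign_prod n (x \<circ> \<pi>) = sign_prod n x"
proof -
  \<comment> \<open>\<open>\<tau>\<close> returns \<open>\<pi> 0\<close> to 0, so
    \<open>\<tau> \<circ> \<pi>\<close> permutes \<open>{1..n}\<close>. As \<open>\<tau>\<close> is
    an involution, \<open>x \<circ> \<pi>\<close> is \<open>x \<circ> \<tau>\<close> with its tail
    permuted.\<close>
  define \<tau> where "\<tau> = Transposition.transpose 0 (\<pi> 0)"
  have "\<pi> 0 \<in> {0..n}" using permutes_in_image[OF \<pi>] by simp
  then have "\<tau> permutes {0..n}"
    by (simp add: \<tau>_def permutes_swap_id)
  then have "\<tau> \<circ> \<pi> permutes {0..n}" by (rule permutes_compose[OF \<pi>])
  moreover have "(\<tau> \<circ> \<pi>) i = i" if "i \<in> {0..n} - {1..n}" for i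
    using that by (cases "i = 0") (auto simp: \<tau>_def)
  ultimately have "\<tau> \<circ> \<pi> permutes {1..n}" by (rule permutes_superset) auto
  then have bij: "bij_betw (\<tau> \<circ> \<pi>) {1..n} {1..n}" by (rule permutes_imp_bij)
  have "sign_prod n (x \<circ> \<pi>) = sign_prod n (x \<circ> \<tau>)"
    by (rule sign_prod_permute_tail[OF bij]) (simp_all add: \<tau>_def)
  also have "\<dots> = sign_prod n x"
  proof (cases "\<pi> 0 = 0")
    case False
    then show ?thesis
      using sign_prod_transpose[OF assms(1), of "\<pi> 0"] \<open>\<pi> 0 \<in> {0..n}\<close> by (simp add: \<tau>_def)
  qed (simp add: \<tau>_def)
  finally show ?thesis .
qed

lemma sign_prod_symmetric_polynomial_in_squares:
  assumes "2 \<le> n"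
  obtains q :: "nat rpoly" where "symmetric_poly_in {0..n} q" "total_degree q = 2 ^ (n - 1)"
    "\<And>x. sign_prod n x = poly_eval q (\<lambda>i. (x i)\<^sup>2)"
proof -
  have "polynomial_in UNIV {0..n} (\<lambda>x. x) (sign_prod n)"
    unfolding sign_prod_def
    by (intro polynomial_in_prod polynomial_in_add polynomial_in_sum polynomial_in_mult
        polynomial_in_const polynomial_in_var) auto
  then have "polynomial_in UNIV {0..n} (\<lambda>x i. (x i)\<^sup>2) (sign_prod n)"
    by (rule even_polynomial_in_squares[rotated]) (use assms sign_prod_sign in auto)
  then obtain q where q: "poly_vars q \<subseteq> {0..n}"
      "\<And>m. lookup q m \<noteq> 0 \<Longrightarrow> monom_degree m = 2 ^ (n - 1)"
      "\<And>x. sign_prod n x = poly_eval q (\<lambda>i. (x i)\<^sup>2)"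
  proof (rule polynomial_in_homogeneous[where N = "2 ^ (n - 1)"])
    fix x :: "nat \<Rightarrow> real" and t :: real assume t: "0 < t"
    \<comment> \<open>Scaling the squares by \<open>t\<close> scales the variables by
      \<open>sqrt t\<close>, which halves the degree of homogeneity.\<close>
    have "(2::nat) ^ n = 2 * 2 ^ (n - 1)" using assms by (simp flip: power_Suc)
    then have "sqrt t ^ 2 ^ n = (sqrt t ^ 2) ^ 2 ^ (n - 1)"
      by (simp only: power_mult)
    then have "sqrt t ^ 2 ^ n = t ^ 2 ^ (n - 1)" using t by simp
    then show "\<exists>x'\<in>UNIV. (\<lambda>i. (x' i)\<^sup>2) = (\<lambda>i. t * (x i)\<^sup>2) \<and>
        sign_prod n x' = t ^ 2 ^ (n - 1) * sign_prod n x"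
      using t by (intro bexI[of _ "\<lambda>i. sqrt t * x i"])
        (simp_all add: sign_prod_scale power_mult_distrib)
  next
    \<comment> \<open>With \<open>x 0 = 1\<close> and all other entries 0, every factor is
      1.\<close>
    show "\<exists>x\<in>UNIV. sign_prod n x \<noteq> 0"
      by (rule bexI[of _ "\<lambda>i. if i = 0 then 1 else 0"]) (simp_all add: sign_prod_def)
  qed blast
  \<comment> \<open>Evenness gave a polynomial in the squares, but not the symmetry of its
    coefficients; averaging supplies it and respects the degrees of the monomials.\<close>
  let ?q = "symmetrize {0..n} q"
  have eval: "sign_prod n x = poly_eval ?q (\<lambda>i. (x i)\<^sup>2)" for x
  proof (rule poly_eval_symmetrize[symmetric])
    fix \<pi> assume "\<pi> permutes {0..n}"
    then show "poly_eval q ((\<lambda>i. (x i)\<^sup>2) \<circ> \<pi>) = sign_prod n x"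
      using sign_prod_permute[OF assms, of \<pi> x] q(3)[of "x \<circ> \<pi>"] by (simp add: o_def)
  qed simp
  have "monom_degree m = 2 ^ (n - 1)" if "lookup ?q m \<noteq> 0" for m
    using symmetrize_nonzero[OF that] q(2) monom_degree_map_key permutes_bij by metis
  moreover have "poly_eval ?q (\<lambda>i. (if i = 0 then 1 else 0)\<^sup>2) \<noteq> 0"
    unfolding eval[symmetric] by (simp add: sign_prod_def)
  ultimately have "total_degree ?q = 2 ^ (n - 1)" by (rule total_degree_homogeneous)
  then show thesis using that symmetric_poly_in_symmetrize[OF q(1)] eval by blast
qed

subsection \<open>Symmetric maps anticommuting with a complex structure\<close>

text \<open>
  A maximiser \<open>v\<close> of \<open>S x \<bullet> x\<close> on the unit sphere of \<open>W\<close> is an eigenvector: the form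
  \<open>m (x \<bullet> x) - S x \<bullet> x\<close> is nonnegative and vanishes at \<open>v\<close>, so its gradient at \<open>v\<close> is zero.
\<close>

lemma symmetric_linear_max_eigenvector:
  fixes S :: "'a::euclidean_space \<Rightarrow> 'a"
  assumes lin: "linear S" and sym: "\<And>x y. S x \<bullet> y = x \<bullet> S y"
    and W: "subspace W" "W \<noteq> {0}" "S ` W \<subseteq> W"
  obtains v where "v \<in> W" "norm v = 1" "S v = (S v \<bullet> v) *\<^sub>R v"
    "\<And>w. w \<in> W \<Longrightarrow> norm w = 1 \<Longrightarrow> S w \<bullet> w \<le> S v \<bullet> v"
proof -
  interpret linear S by (rule lin)
  let ?K = "sphere 0 1 \<inter> W"
  have "compact ?K"
    by (intro compact_Int_closed compact_sphere closed_subspace W)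
  moreover have "?K \<noteq> {}"
  proof -
    obtain w where "w \<in> W" "w \<noteq> 0" using W subspace_0 by blast
    then have "w /\<^sub>R norm w \<in> ?K" using W(1) by (simp add: subspace_scale)
    then show ?thesis by blast
  qed
  moreover have "continuous_on ?K (\<lambda>x. S x \<bullet> x)"
    by (intro continuous_intros linear_continuous_on linear_conv_bounded_linear[THEN iffD1] lin)
  ultimately obtain v where v: "v \<in> ?K" and max: "\<And>w. w \<in> ?K \<Longrightarrow> S w \<bullet> w \<le> S v \<bullet> v"
    using continuous_attains_sup by meson
  define m where "m = S v \<bullet> v"
  have vv: "v \<bullet> v = 1" "v \<in> W" using v by (simp_all add: dot_square_norm)
  have Q: "S w \<bullet> w \<le> m * (w \<bullet> w)" if "w \<in> W" for w
  proof (cases "w = 0")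
    case False
    have "w /\<^sub>R norm w \<in> ?K" using that W(1) False by (simp add: subspace_scale)
    from max[OF this] have "(S w \<bullet> w) / (norm w * norm w) \<le> m"
      by (simp add: m_def scaleR field_simps)
    then show ?thesis using False by (simp add: field_simps dot_square_norm power2_eq_square)
  qed (simp add: zero)
  \<comment> \<open>Half the gradient at \<open>v\<close> of the form
    \<open>m * (x \<bullet> x) - S x \<bullet> x\<close>.\<close>
  define w where "w = m *\<^sub>R v - S v"
  have wW: "w \<in> W" unfolding w_def using vv W by (intro subspace_diff subspace_scale) auto
  define q where "q = m * (w \<bullet> w) - S w \<bullet> w"
  \<comment> \<open>This is the form at \<open>v + t *\<^sub>R w\<close>: the constant term
    vanishes, the linear coefficient is \<open>2 * (w \<bullet> w)\<close> and the quadratic one is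
    \<open>q\<close>.\<close>
  have quad: "0 \<le> 2 * t * (w \<bullet> w) + t\<^sup>2 * q" for t
  proof -
    have "v + t *\<^sub>R w \<in> W" using vv wW W(1) by (intro subspace_add subspace_scale)
    from Q[OF this]
    have "m + t * (S v \<bullet> w) + t * (S w \<bullet> v) + t * t * (S w \<bullet> w)
        \<le> m * (1 + 2 * t * (v \<bullet> w) + t * t * (w \<bullet> w))"
      by (simp add: add scaleR inner_add_left inner_add_right vv inner_commute[of w v]
          algebra_simps m_def[symmetric])
    moreover have "S w \<bullet> v = S v \<bullet> w" using sym[of w v] by (simp add: inner_commute)
    ultimately have "m + 2 * (t * (S v \<bullet> w)) + t * t * (S w \<bullet> w)
        \<le> m + 2 * (t * (m * (v \<bullet> w))) + t * t * (m * (w \<bullet> w))"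
      by (simp add: algebra_simps)
    moreover have "t * (w \<bullet> w) = t * (m * (v \<bullet> w)) - t * (S v \<bullet> w)"
      unfolding right_diff_distrib[symmetric] by (subst w_def) (simp add: inner_diff_left)
    ultimately have "0 \<le> 2 * (t * (w \<bullet> w)) + t * t * (m * (w \<bullet> w)) - t * t * (S w \<bullet> w)"
      by linarith
    then show ?thesis by (simp add: q_def power2_eq_square right_diff_distrib mult_ac)
  qed
  have "w = 0"
  proof (rule ccontr)
    assume "w \<noteq> 0"
    then have a: "0 < w \<bullet> w" by simp
    have q: "0 \<le> q" using Q[OF wW] by (simp add: q_def)
    \<comment> \<open>For a small negative \<open>t\<close> the linear term dominates;
      \<open>q + 1\<close> keeps the denominator positive when \<open>q = 0\<close>. With this
      choice the form equals \<open>t * (w \<bullet> w) - t\<^sup>2\<close>, which is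
      negative.\<close>
    define t where "t = - (w \<bullet> w) / (q + 1)"
    have t: "t < 0" "t * (q + 1) = - (w \<bullet> w)" using a q by (simp_all add: t_def divide_neg_pos)
    have tq: "t * q = - (w \<bullet> w) - t" using t(2) unfolding distrib_left by linarith
    have "t\<^sup>2 * q = t * (t * q)" by (simp add: power2_eq_square)
    also have "\<dots> = - (t * (w \<bullet> w)) - t\<^sup>2"
      unfolding tq by (simp add: power2_eq_square right_diff_distrib)
    finally have "2 * t * (w \<bullet> w) + t\<^sup>2 * q = t * (w \<bullet> w) - t\<^sup>2" by linarith
    moreover have "t * (w \<bullet> w) < 0" using t(1) a by (rule mult_neg_pos)
    ultimately show False using quad[of t] zero_le_power2[of t] by linarith
  qed
  then have "S v = (S v \<bullet> v) *\<^sub>R v" by (simp add: w_def m_def)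
  then show thesis using that[of v] v max by simp
qed

section \<open>Eigenframes adapted to the complex structure\<close>

locale anticommuting_pair =
  fixes S J :: "'a::euclidean_space \<Rightarrow> 'a"
  assumes lin_S: "linear S" and lin_J: "linear J"
    and sym_S: "\<And>x y. S x \<bullet> y = x \<bullet> S y"
    and skew_J: "\<And>x y. J x \<bullet> y = - (x \<bullet> J y)"
    and J_J: "\<And>x. J (J x) = - x"
    and S_J: "\<And>x. S (J x) = - J (S x)"
begin

lemma inner_J_J: "J x \<bullet> J y = x \<bullet> y"
  by (simp add: skew_J J_J)

lemma inner_J_self: "x \<bullet> J x = 0"
  using skew_J[of x x] by (simp add: inner_commute)

text \<open>Half of an orthonormal eigenbasis: since \<open>S\<close> and \<open>J\<close>
  anticommute, the images under \<open>J\<close> are eigenvectors for the negated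
  eigenvalues.\<close>

definition eigenframe :: "'a set \<Rightarrow> bool" where
  "eigenframe E \<longleftrightarrow> finite E \<and>
    (\<forall>e\<in>E. S e = (S e \<bullet> e) *\<^sub>R e \<and> 0 \<le> S e \<bullet> e) \<and>
    (\<forall>e\<in>E. \<forall>f\<in>E. e \<bullet> f = (if e = f then 1 else 0) \<and> e \<bullet> J f = 0)"

text \<open>Induction on the dimension: a maximising eigenvector \<open>v\<close> and
  \<open>J v\<close> span an invariant plane, and its orthogonal complement in \<open>W\<close> is
  again invariant under both maps.\<close>

lemma eigenframe_exists_subspace:
  assumes "subspace W" "S ` W \<subseteq> W" "J ` W \<subseteq> W"
  shows "\<exists>E. eigenframe E \<and> E \<subseteq> W \<and> W \<subseteq> span (E \<union> J ` E)"
  using assms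
proof (induction "dim W" arbitrary: W rule: less_induct)
  case less
  show ?case
  proof (cases "W = {0}")
    case True
    then show ?thesis by (intro exI[of _ "{}"]) (simp add: eigenframe_def)
  next
    case False
    obtain v where v: "v \<in> W" "norm v = 1" "S v = (S v \<bullet> v) *\<^sub>R v"
      and max: "\<And>w. w \<in> W \<Longrightarrow> norm w = 1 \<Longrightarrow> S w \<bullet> w \<le> S v \<bullet> v"
      using symmetric_linear_max_eigenvector[OF lin_S sym_S less.prems(1) False less.prems(2)]
      by metis
    define m where "m = S v \<bullet> v"
    have Sv: "S v = m *\<^sub>R v" using v(3) by (simp add: m_def)
    have vv: "v \<bullet> v = 1" using v(2) by (simp add: dot_square_norm)
    have JvW: "J v \<in> W" using v(1) less.prems(3) by blast
    have SJv: "S (J v) = - m *\<^sub>R J v"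
      using linear_scale[OF lin_J] by (simp add: S_J Sv)
    \<comment> \<open>\<open>J v\<close> is a unit vector of \<open>W\<close> at which the quadratic
      form is \<open>- m\<close>, so maximality of \<open>m\<close> forces
      \<open>0 \<le> m\<close>.\<close>
    have "norm (J v) = 1" using v(2) by (simp add: norm_eq_sqrt_inner inner_J_J)
    then have "S (J v) \<bullet> J v \<le> m" using max[OF JvW] by (simp add: m_def)
    then have m: "0 \<le> m" by (simp add: SJv inner_J_J vv)
    let ?W = "W \<inter> {x. v \<bullet> x = 0} \<inter> {x. J v \<bullet> x = 0}"
    have sub: "subspace ?W"
      by (intro subspace_inter less.prems(1) subspace_hyperplane)
    have "v \<notin> ?W" using vv by simp
    then have "?W \<subset> W" using v(1) by blast
    then have "dim ?W < dim W"
      by (intro dim_psubset) (simp add: span_eq_iff[THEN iffD2] sub less.prems(1))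
    \<comment> \<open>Symmetry moves \<open>S\<close> onto \<open>v\<close> and \<open>J v\<close>,
      which are eigenvectors.\<close>
    moreover have "S ` ?W \<subseteq> ?W"
      using less.prems(2) by (auto simp: sym_S[symmetric] Sv SJv)
    moreover have "J ` ?W \<subseteq> ?W"
    proof -
      have "v \<bullet> J x = 0 \<and> J v \<bullet> J x = 0" if "x \<in> ?W" for x
        using that skew_J[of v x] inner_J_J[of v x] by simp
      then show ?thesis using less.prems(3) by blast
    qed
    ultimately obtain E where E: "eigenframe E" "E \<subseteq> ?W" "?W \<subseteq> span (E \<union> J ` E)"
      using less.hyps[OF _ sub] by blast
    let ?E = "insert v E"
    have orth: "v \<bullet> e = 0" "e \<bullet> v = 0" "v \<bullet> J e = 0" "e \<bullet> J v = 0" "v \<noteq> e" if "e \<in> E" for e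
    proof -
      have e: "v \<bullet> e = 0" "J v \<bullet> e = 0" using that E(2) by auto
      then show "v \<bullet> e = 0" "e \<bullet> v = 0" "v \<bullet> J e = 0" "e \<bullet> J v = 0"
        using skew_J[of v e] by (simp_all add: inner_commute)
      show "v \<noteq> e" using e vv by auto
    qed
    have "eigenframe ?E"
      using E(1) orth m vv inner_J_self[of v] v(3) unfolding eigenframe_def
      by (auto simp: m_def)
    moreover have "?E \<subseteq> W" using E(2) v(1) by blast
    moreover have "W \<subseteq> span (?E \<union> J ` ?E)"
    proof
      fix x assume x: "x \<in> W"
      let ?y = "x - (v \<bullet> x) *\<^sub>R v - (J v \<bullet> x) *\<^sub>R J v"
      have "?y \<in> ?W"
        using x v(1) JvW vv inner_J_J[of v v] inner_J_self[of v] less.prems(1)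
        by (simp add: subspace_diff subspace_scale inner_diff_right inner_commute[of "J v" v])
      then have "?y \<in> span (?E \<union> J ` ?E)"
        using E(3) span_mono[of "E \<union> J ` E" "?E \<union> J ` ?E"] by blast
      moreover have "v \<in> span (?E \<union> J ` ?E)" "J v \<in> span (?E \<union> J ` ?E)"
        by (auto intro: span_base)
      ultimately have "?y + (J v \<bullet> x) *\<^sub>R J v + (v \<bullet> x) *\<^sub>R v \<in> span (?E \<union> J ` ?E)"
        by (intro span_add span_scale)
      then show "x \<in> span (?E \<union> J ` ?E)" by simp
    qed
    ultimately show ?thesis by blast
  qed
qed

lemma eigenframe_exists: "\<exists>E. eigenframe E \<and> span (E \<union> J ` E) = UNIV"
  using eigenframe_exists_subspace[of UNIV] by auto

lemma eigenframe_basis: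
  assumes "eigenframe E"
  shows "inj_on J E" "E \<inter> J ` E = {}" "pairwise orthogonal (E \<union> J ` E)"
    "\<And>b. b \<in> E \<union> J ` E \<Longrightarrow> norm b = 1"
proof -
  have E: "e \<bullet> f = (if e = f then 1 else 0)" "e \<bullet> J f = 0" "J f \<bullet> e = 0"
    if "e \<in> E" "f \<in> E" for e f
    using assms that by (auto simp: eigenframe_def inner_commute)
  show "inj_on J E"
    by (rule inj_onI) (metis J_J minus_equation_iff)
  show "E \<inter> J ` E = {}"
  proof -
    have "e \<noteq> J f" if "e \<in> E" "f \<in> E" for e f
      using E(1)[OF that(1) that(1)] E(2)[OF that] by auto
    then show ?thesis by blast
  qed
  show "pairwise orthogonal (E \<union> J ` E)"
    unfolding pairwise_def orthogonal_def using E by (auto simp: inner_J_J)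
  show "norm b = 1" if "b \<in> E \<union> J ` E" for b
    using that E by (auto simp: norm_eq_sqrt_inner inner_J_J)
qed

end

section \<open>Traces and eigenspaces in an orthonormal basis\<close>

lemma trace_orthonormal_basis:
  fixes T :: "'a::euclidean_space \<Rightarrow> 'a"
  assumes T: "linear T" and D: "finite D" "pairwise orthogonal D" "\<And>d. d \<in> D \<Longrightarrow> norm d = 1"
    "span D = UNIV"
  shows "(\<Sum>b\<in>Basis. T b \<bullet> b) = (\<Sum>d\<in>D. T d \<bullet> d)"
proof -
  interpret linear T by (rule T)
  \<comment> \<open>Each standard basis vector is expanded in \<open>D\<close>; after swapping the
    sums, the sum over \<open>Basis\<close> collapses to an inner product.\<close>
  have "(\<Sum>b\<in>Basis. T b \<bullet> b) = (\<Sum>b\<in>Basis. T (\<Sum>d\<in>D. (b \<bullet> d) *\<^sub>R d) \<bullet> b)"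
    using orthonormal_basis_expand[OF D(2,3) _ D(1)] D(4) by simp
  also have "\<dots> = (\<Sum>b\<in>Basis. \<Sum>d\<in>D. (T d \<bullet> b) * (d \<bullet> b))"
    by (simp add: sum scaleR inner_sum_left) (simp add: inner_commute mult.commute)
  also have "\<dots> = (\<Sum>d\<in>D. \<Sum>b\<in>Basis. (T d \<bullet> b) * (d \<bullet> b))"
    by (rule sum.swap)
  also have "\<dots> = (\<Sum>d\<in>D. T d \<bullet> d)"
    by (simp add: euclidean_inner[symmetric])
  finally show ?thesis .
qed

text \<open>When an eigenvector for \<open>t\<close> is expanded in \<open>D\<close>, independence
  makes its coefficient at \<open>d\<close> vanish unless \<open>\<mu> d = t\<close>.\<close>

lemma dim_eigenspace_orthonormal_basis:
  fixes T :: "'a::euclidean_space \<Rightarrow> 'a"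
  assumes T: "linear T" and D: "finite D" "pairwise orthogonal D" "\<And>d. d \<in> D \<Longrightarrow> norm d = 1"
    "span D = UNIV" and ev: "\<And>d. d \<in> D \<Longrightarrow> T d = \<mu> d *\<^sub>R d"
  shows "dim {v. T v = t *\<^sub>R v} = card {d \<in> D. \<mu> d = t}"
proof -
  interpret linear T by (rule T)
  let ?D = "{d \<in> D. \<mu> d = t}"
  have indep: "independent D"
    using D(2) by (rule pairwise_orthogonal_independent) (use D(3) in force)
  have "v \<in> span ?D" if v: "T v = t *\<^sub>R v" for v
  proof -
    have exp: "x = (\<Sum>d\<in>D. (x \<bullet> d) *\<^sub>R d)" for x
      using orthonormal_basis_expand[OF D(2,3) _ D(1)] D(4) by simp
    have sum0: "(\<Sum>d\<in>D. ((v \<bullet> d) * (\<mu> d - t)) *\<^sub>R d) = 0"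
    proof -
      have "T v = (\<Sum>d\<in>D. (v \<bullet> d) *\<^sub>R T d)"
        by (subst exp) (simp add: sum scaleR)
      then have "t *\<^sub>R (\<Sum>d\<in>D. (v \<bullet> d) *\<^sub>R d) = (\<Sum>d\<in>D. (v \<bullet> d) *\<^sub>R (\<mu> d *\<^sub>R d))"
        using v exp[of v] ev by simp
      then show ?thesis
        by (simp add: scaleR_sum_right algebra_simps sum_subtractf)
    qed
    have "(v \<bullet> d) *\<^sub>R d \<in> span ?D" if "d \<in> D" for d
    proof (cases "\<mu> d = t")
      case True
      then show ?thesis using that by (intro span_scale span_base) simp
    next
      case False
      then have "v \<bullet> d = 0" using independentD[OF indep D(1) subset_refl sum0 that] by simp
      then show ?thesis by (simp add: span_zero)
    qed
    then have "(\<Sum>d\<in>D. (v \<bullet> d) *\<^sub>R d) \<in> span ?D" by (rule span_sum)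
    then show ?thesis using exp[of v] by simp
  qed
  moreover have "T v = t *\<^sub>R v" if "v \<in> span ?D" for v
    using that
  proof (induction rule: span_induct)
    case base
    show ?case by (rule subspaceI) (simp_all add: zero add scaleR algebra_simps)
  qed (use ev in auto)
  ultimately have "{v. T v = t *\<^sub>R v} = span ?D" by blast
  moreover have "independent ?D" using indep by (rule independent_mono) auto
  ultimately show ?thesis using dim_span_eq_card_independent[of ?D] by simp
qed

subsection \<open>The Lagrangian Monge-Ampere operator\<close>

text \<open>Recovers multiplicities from the list with both signs. For \<open>t = 0\<close> the two
  counts coincide, for positive \<open>t\<close> the negated entries contribute nothing, and for
  negative \<open>t\<close> the sets compared are empty.\<close>

lemma card_nonneg_list_cancel_sign:
  fixes l l' :: "nat \<Rightarrow> real"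
  assumes nn: "\<And>i. i \<in> I \<Longrightarrow> 0 \<le> l i" "\<And>i. i \<in> I \<Longrightarrow> 0 \<le> l' i"
    and eq: "card {i\<in>I. l i = t} + card {i\<in>I. - l i = t} =
      card {i\<in>I. l' i = t} + card {i\<in>I. - l' i = t}"
  shows "card {i\<in>I. l i = t} = card {i\<in>I. l' i = t}"
proof -
  consider "t < 0" | "t = 0" | "0 < t" by linarith
  then show ?thesis
  proof cases
    case 1
    then have "{i\<in>I. l i = t} = {}" "{i\<in>I. l' i = t} = {}" using nn by force+
    then show ?thesis by (simp only:)
  next
    case 2
    then have "{i\<in>I. - l i = t} = {i\<in>I. l i = t}" "{i\<in>I. - l' i = t} = {i\<in>I. l' i = t}"
      by auto
    then show ?thesis using eq by simp
  next
    case 3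
    then have "{i\<in>I. - l i = t} = {}" "{i\<in>I. - l' i = t} = {}" using nn by force+
    then show ?thesis using eq by (simp only: card.empty add_0_right)
  qed
qed

text \<open>Equal multiplicities of all values mean equal multisets, and these are related by a
  permutation of the indices.\<close>

lemma skew_eigenvalues_unique:
  fixes A :: "(complex ^ 'n) \<Rightarrow>\<^sub>L (complex ^ 'n::finite)"
  assumes "skew_eigenvalues A l" "skew_eigenvalues A l'"
  obtains \<sigma> where "\<sigma> permutes {1..CARD('n)}" "\<And>i. i \<in> {1..CARD('n)} \<Longrightarrow> l i = l' (\<sigma> i)"
proof -
  let ?I = "{1..CARD('n)}"
  have nn: "0 \<le> l i" "0 \<le> l' i" if "i \<in> ?I" for i
    using assms that by (simp_all add: skew_eigenvalues_def)
  have "card {i\<in>?I. l i = t} = card {i\<in>?I. l' i = t}" for t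
    by (rule card_nonneg_list_cancel_sign[OF nn])
       (use assms in \<open>simp_all only: skew_eigenvalues_def\<close>)
  then have "image_mset l (mset_set ?I) = image_mset l' (mset_set ?I)"
    by (intro multiset_eqI) (simp add: count_image_mset_eq_card_vimage)
  from image_mset_eq_implies_permutes[OF _ this]
  obtain \<sigma> where "\<sigma> permutes ?I" "\<forall>i\<in>?I. l i = l' (\<sigma> i)" by auto
  then show thesis using that by blast
qed

text \<open>Frees the operator from the choice made by \<open>SOME\<close>: two admissible lists
  differ by a permutation of the tail, under which the sign product is invariant.\<close>

lemma M_Lag_eq_sign_prod:
  fixes A :: "(complex ^ 'n) \<Rightarrow>\<^sub>L (complex ^ 'n::finite)"
  assumes "skew_eigenvalues A l"
  shows "M_Lag A = sign_prod CARD('n) (l(0 := half_trace A))"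
proof -
  define l' where "l' = (SOME l. skew_eigenvalues A l)"
  have "skew_eigenvalues A l'" unfolding l'_def by (rule someI[of "skew_eigenvalues A", OF assms])
  from skew_eigenvalues_unique[OF this assms] obtain \<sigma> where
    \<sigma>: "\<sigma> permutes {1..CARD('n)}" "\<And>i. i \<in> {1..CARD('n)} \<Longrightarrow> l' i = l (\<sigma> i)" by blast
  have "M_Lag A = sign_prod CARD('n) (l'(0 := half_trace A))"
    by (simp add: M_Lag_def sign_prod_def l'_def[symmetric])
  also have "\<dots> = sign_prod CARD('n) (l(0 := half_trace A))"
  proof (rule sign_prod_permute_tail[OF permutes_imp_bij[OF \<sigma>(1)]])
    fix i assume i: "i \<in> {1..CARD('n)}"
    \<comment> \<open>Index 0 holds the trace, so \<open>\<sigma>\<close> must not reach it.\<close>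
    then have "\<sigma> i \<noteq> 0" using permutes_in_image[OF \<sigma>(1), of i] by auto
    then show "(l'(0 := half_trace A)) i = (l(0 := half_trace A)) (\<sigma> i)"
      using i \<sigma>(2) by simp
  qed simp
  finally show ?thesis .
qed

section \<open>The eigenvalue list of the skew part\<close>

lemma cplx_J_inner: "blinfun_apply cplx_J x \<bullet> y = - (x \<bullet> blinfun_apply cplx_J y)"
  by transfer (simp add: inner_vec_def inner_complex_def sum_negf[symmetric] algebra_simps)

lemma cplx_J_cplx_J: "blinfun_apply cplx_J (blinfun_apply cplx_J x) = - x"
  by transfer (simp add: vec_eq_iff mult.assoc[symmetric])

lemma skew_part_apply:
  "blinfun_apply (skew_part A) x = (1/2) *\<^sub>R (blinfun_apply A x +
     blinfun_apply cplx_J (blinfun_apply A (blinfun_apply cplx_J x)))"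
  by (simp add: skew_part_def blinfun.add_left blinfun.scaleR_left)

lemma anticommuting_pair_skew_part:
  assumes "A \<in> Sym2"
  shows "anticommuting_pair (blinfun_apply (skew_part A)) (blinfun_apply cplx_J)"
proof (rule anticommuting_pair.intro)
  show "linear (blinfun_apply (skew_part A))" "linear (blinfun_apply cplx_J)"
    by (rule bounded_linear.linear[OF blinfun.bounded_linear_right])+
  have sym: "blinfun_apply A x \<bullet> y = x \<bullet> blinfun_apply A y" for x y
    using assms by (simp add: Sym2_def)
  show "blinfun_apply (skew_part A) x \<bullet> y = x \<bullet> blinfun_apply (skew_part A) y" for x y
    by (simp add: skew_part_apply inner_add_left inner_add_right cplx_J_inner sym)
  show "blinfun_apply cplx_J x \<bullet> y = - (x \<bullet> blinfun_apply cplx_J y)" for x y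
    by (rule cplx_J_inner)
  show "blinfun_apply cplx_J (blinfun_apply cplx_J x) = - x" for x
    by (rule cplx_J_cplx_J)
  show "blinfun_apply (skew_part A) (blinfun_apply cplx_J x) =
      - blinfun_apply cplx_J (blinfun_apply (skew_part A) x)" for x
    by (simp add: skew_part_apply cplx_J_cplx_J blinfun.add_right blinfun.scaleR_right
        blinfun.minus_right flip: scaleR_minus_right)
qed

text \<open>An eigenframe is enumerated by \<open>{1..CARD('n)}\<close>. In the basis completed by
  \<open>J\<close>, opposite eigenvalues have the same even powers, whence the factor 1/2 before the
  trace.\<close>

lemma skew_eigenvalues_exist:
  fixes A :: "(complex ^ 'n) \<Rightarrow>\<^sub>L (complex ^ 'n::finite)"
  assumes "A \<in> Sym2"
  obtains l where "skew_eigenvalues A l"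
    "\<And>k. (\<Sum>i\<in>{1..CARD('n)}. (l i)\<^sup>2 ^ k) =
      (1/2) * (\<Sum>b\<in>Basis. (blinfun_apply (skew_part A) ^^ (2 * k)) b \<bullet> b)"
proof -
  define S where "S = blinfun_apply (skew_part A)"
  define J where "J = blinfun_apply (cplx_J :: (complex ^ 'n) \<Rightarrow>\<^sub>L (complex ^ 'n))"
  interpret anticommuting_pair S J
    unfolding S_def J_def by (rule anticommuting_pair_skew_part[OF assms])
  obtain E where E: "eigenframe E" and span: "span (E \<union> J ` E) = UNIV"
    using eigenframe_exists by blast
  let ?D = "E \<union> J ` E"
  note basis = eigenframe_basis[OF E]
  have fin: "finite E" "finite ?D" using E by (simp_all add: eigenframe_def)
  define \<mu> where "\<mu> b = S b \<bullet> b" for b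
  have \<mu>E: "S e = \<mu> e *\<^sub>R e" "0 \<le> \<mu> e" if "e \<in> E" for e
    using E that by (simp_all add: eigenframe_def \<mu>_def)
  have \<mu>J: "\<mu> (J e) = - \<mu> e" for e
    by (simp add: \<mu>_def S_J inner_J_J)
  have \<mu>D: "S b = \<mu> b *\<^sub>R b" if "b \<in> ?D" for b
    using that \<mu>E linear_scale[OF lin_J] by (auto simp: \<mu>J S_J)
  have "independent ?D"
    using basis(3) by (rule pairwise_orthogonal_independent) (use basis(4)[of 0] in auto)
  then have "card ?D = dim (UNIV :: (complex ^ 'n) set)"
    using dim_span_eq_card_independent[of ?D] span by simp
  \<comment> \<open>The real dimension is \<open>2 * CARD('n)\<close>, and \<open>J\<close> is
    injective on \<open>E\<close>, so each half has \<open>CARD('n)\<close> elements.\<close>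
  then have "card E + card (J ` E) = 2 * CARD('n)"
    using fin basis(2) by (simp add: card_Un_disjoint)
  then have card: "card E = CARD('n)" using basis(1) by (simp add: card_image)
  have "\<exists>e. bij_betw e {1..CARD('n)} E"
    by (rule finite_same_card_bij[OF finite_atLeastAtMost fin(1)])
      (simp only: card card_atLeastAtMost diff_Suc_1)
  then obtain e where e: "bij_betw e {1..CARD('n)} E" by (elim exE)
  have card_e: "card {i\<in>{1..CARD('n)}. P (e i)} = card {b\<in>E. P b}" for P
  proof -
    have "{b\<in>E. P b} = e ` {i\<in>{1..CARD('n)}. P (e i)}"
      using bij_betw_imp_surj_on[OF e] by blast
    moreover have "inj_on e {i\<in>{1..CARD('n)}. P (e i)}"
      by (rule inj_on_subset[OF bij_betw_imp_inj_on[OF e]]) blast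
    ultimately show ?thesis by (simp only: card_image)
  qed
  have "dim {v. S v = t *\<^sub>R v} =
      card {i\<in>{1..CARD('n)}. \<mu> (e i) = t} + card {i\<in>{1..CARD('n)}. - \<mu> (e i) = t}" for t
  proof -
    \<comment> \<open>An eigenvalue \<open>t\<close> on the image of \<open>E\<close> under
      \<open>J\<close> comes from \<open>- t\<close> on \<open>E\<close>.\<close>
    have "{b \<in> ?D. \<mu> b = t} = {b\<in>E. \<mu> b = t} \<union> J ` {b\<in>E. - \<mu> b = t}"
      by (auto simp: \<mu>J)
    then have "card {b \<in> ?D. \<mu> b = t} = card {b\<in>E. \<mu> b = t} + card (J ` {b\<in>E. - \<mu> b = t})"
      using fin basis(2) by (subst card_Un_disjoint[symmetric]) auto
    also have "card (J ` {b\<in>E. - \<mu> b = t}) = card {b\<in>E. - \<mu> b = t}"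
      by (rule card_image) (rule inj_on_subset[OF basis(1)], auto)
    finally have "card {b \<in> ?D. \<mu> b = t} = card {b\<in>E. \<mu> b = t} + card {b\<in>E. - \<mu> b = t}" .
    moreover have "dim {v. S v = t *\<^sub>R v} = card {b \<in> ?D. \<mu> b = t}"
      by (rule dim_eigenspace_orthonormal_basis[OF lin_S fin(2) basis(3,4) span \<mu>D])
    ultimately show ?thesis by (simp only: card_e[of "\<lambda>b. \<mu> b = t"] card_e[of "\<lambda>b. - \<mu> b = t"])
  qed
  then have "skew_eigenvalues A (\<lambda>i. \<mu> (e i))"
    using \<mu>E(2) bij_betw_apply[OF e] by (simp add: skew_eigenvalues_def S_def)
  moreover have "(\<Sum>i\<in>{1..CARD('n)}. (\<mu> (e i))\<^sup>2 ^ k) = (1/2) * (\<Sum>b\<in>Basis. (S ^^ (2 * k)) b \<bullet> b)" for k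
  proof -
    have lin: "linear (S ^^ j)" for j
      by (induction j) (simp_all only: funpow.simps linear_id linear_compose[OF _ lin_S])
    have pow: "(S ^^ j) b = \<mu> b ^ j *\<^sub>R b" if "b \<in> ?D" for j b
      by (induction j) (simp_all add: linear_scale[OF lin_S] \<mu>D[OF that])
    have "(\<Sum>b\<in>Basis. (S ^^ (2 * k)) b \<bullet> b) = (\<Sum>b\<in>?D. (S ^^ (2 * k)) b \<bullet> b)"
      by (rule trace_orthonormal_basis[OF lin fin(2) basis(3,4) span])
    also have "\<dots> = (\<Sum>b\<in>?D. (\<mu> b)\<^sup>2 ^ k)"
      by (rule sum.cong) (use basis(4) in \<open>simp_all add: pow power_mult dot_square_norm\<close>)
    also have "\<dots> = (\<Sum>b\<in>E. (\<mu> b)\<^sup>2 ^ k) + (\<Sum>b\<in>J ` E. (\<mu> b)\<^sup>2 ^ k)"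
      using fin basis(2) by (intro sum.union_disjoint) auto
    also have "(\<Sum>b\<in>J ` E. (\<mu> b)\<^sup>2 ^ k) = (\<Sum>b\<in>E. (\<mu> b)\<^sup>2 ^ k)"
      by (simp add: sum.reindex[OF basis(1)] \<mu>J)
    also have "(\<Sum>b\<in>E. (\<mu> b)\<^sup>2 ^ k) = (\<Sum>i\<in>{1..CARD('n)}. (\<mu> (e i))\<^sup>2 ^ k)"
      by (rule sum.reindex_bij_betw[OF e, symmetric])
    finally show ?thesis by simp
  qed
  ultimately show thesis using that[of "\<lambda>i. \<mu> (e i)"] unfolding S_def by blast
qed

section \<open>Linear coordinates and polynomial dependence on the endomorphism\<close>

lemma subspace_Sym2: "subspace Sym2"
  by (rule subspaceI)
     (simp_all add: Sym2_def blinfun.add_left blinfun.scaleR_left inner_add_left inner_add_right)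

text \<open>The matrix units \<open>?e\<close> span all bounded linear maps, so an independent set
  is finite.\<close>

lemma finite_basis_blinfun:
  fixes V :: "('a::euclidean_space \<Rightarrow>\<^sub>L 'b::euclidean_space) set"
  assumes "subspace V"
  obtains B where "finite B" "independent B" "span B = V"
proof -
  obtain B where B: "B \<subseteq> V" "independent B" "V \<subseteq> span B"
    by (rule maximal_independent_subset)
  let ?e = "\<lambda>(i, j). blinfun_of_matrix (\<lambda>i' j'. if i' = i \<and> j' = j then 1 else 0) :: 'a \<Rightarrow>\<^sub>L 'b"
  have "f \<in> span (?e ` (Basis \<times> Basis))" for f
  proof -
    have "f = (\<Sum>p\<in>Basis \<times> Basis. (f (snd p) \<bullet> fst p) *\<^sub>R ?e p)"
    proof (rule blinfun_euclidean_eqI)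
      fix k :: 'a assume k: "k \<in> Basis"
      have "(\<Sum>p\<in>Basis \<times> Basis. (f (snd p) \<bullet> fst p) *\<^sub>R ?e p) k =
          (\<Sum>i\<in>Basis. \<Sum>j\<in>Basis. (f j \<bullet> i) *\<^sub>R (?e (i, j) k))"
        by (simp add: blinfun.sum_left blinfun.scaleR_left sum.cartesian_product case_prod_beta)
      also have "\<dots> = (\<Sum>i\<in>Basis. \<Sum>j\<in>Basis. if j = k then (f k \<bullet> i) *\<^sub>R i else 0)"
      proof (intro sum.cong refl)
        fix i :: 'b and j :: 'a assume ij: "i \<in> Basis" "j \<in> Basis"
        have "?e (i, j) k = (\<Sum>i'\<in>Basis. \<Sum>j'\<in>Basis. if i' = i \<and> j' = j then (k \<bullet> j) *\<^sub>R i else 0)"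
          unfolding prod.case blinfun_of_matrix_apply by (intro sum.cong refl) auto
        also have "\<dots> = (\<Sum>i'\<in>Basis. if i' = i then (k \<bullet> j) *\<^sub>R i else 0)"
          using ij by (intro sum.cong refl) simp
        also have "\<dots> = (k \<bullet> j) *\<^sub>R i" using ij by simp
        finally show "(f j \<bullet> i) *\<^sub>R (?e (i, j) k) = (if j = k then (f k \<bullet> i) *\<^sub>R i else 0)"
          using ij k by (simp add: inner_Basis)
      qed
      also have "\<dots> = f k" using k by (simp add: euclidean_representation)
      finally show "f k = (\<Sum>p\<in>Basis \<times> Basis. (f (snd p) \<bullet> fst p) *\<^sub>R ?e p) k" by simp
    qed
    also have "\<dots> \<in> span (?e ` (Basis \<times> Basis))"
      by (intro span_sum span_scale span_base imageI)
    finally show ?thesis .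
  qed
  then have "finite B"
    using independent_span_bound[OF _ B(2), of "?e ` (Basis \<times> Basis)"] by auto
  moreover have "span B = V" using B assms by (metis span_eq_iff span_mono subset_antisym)
  ultimately show thesis using that B(2) by blast
qed

lemma polynomial_in_linear:
  assumes B: "finite B" "independent B" and h: "linear h"
  shows "polynomial_in (span B) B (representation B) h"
proof (rule polynomial_in_cong[THEN iffD2])
  fix v assume "v \<in> span B"
  then have "v = (\<Sum>b\<in>B. representation B v b *\<^sub>R b)"
    using real_vector.sum_representation_eq[OF B(2) _ B(1) subset_refl] by simp
  then have "h v = h (\<Sum>b\<in>B. representation B v b *\<^sub>R b)" by simp
  also have "\<dots> = (\<Sum>b\<in>B. representation B v b * h b)"
    by (simp add: linear_sum[OF h] linear_scale[OF h])
  finally show "h v = (\<Sum>b\<in>B. representation B v b * h b)" .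
next
  show "polynomial_in (span B) B (representation B) (\<lambda>v. \<Sum>b\<in>B. representation B v b * h b)"
    by (intro polynomial_in_sum polynomial_in_mult polynomial_in_const polynomial_in_var)
qed

text \<open>The entries of a power are sums of products of entries: one factor is split off and its
  argument expanded in \<open>Basis\<close>. The induction hypothesis is used at every basis vector,
  hence \<open>arbitrary: y\<close>.\<close>

lemma polynomial_in_funpow:
  fixes F :: "'s \<Rightarrow> 'a::euclidean_space \<Rightarrow> 'a"
  assumes "\<And>s. s \<in> X \<Longrightarrow> linear (F s)"
    and "\<And>x y. polynomial_in X B c (\<lambda>s. F s x \<bullet> y)"
  shows "polynomial_in X B c (\<lambda>s. (F s ^^ k) x \<bullet> y)"
proof (induction k arbitrary: y)
  case 0
  show ?case by (simp add: polynomial_in_const)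
next
  case (Suc k)
  show ?case
  proof (rule polynomial_in_cong[THEN iffD2])
    fix s assume "s \<in> X"
    let ?z = "(F s ^^ k) x"
    have "F s ?z = F s (\<Sum>d\<in>Basis. (?z \<bullet> d) *\<^sub>R d)" by (simp add: euclidean_representation)
    also have "\<dots> = (\<Sum>d\<in>Basis. (?z \<bullet> d) *\<^sub>R F s d)"
      using assms(1)[OF \<open>s \<in> X\<close>] by (simp add: linear_sum linear_scale)
    finally show "(F s ^^ Suc k) x \<bullet> y = (\<Sum>d\<in>Basis. (?z \<bullet> d) * (F s d \<bullet> y))"
      by (simp add: inner_sum_left)
  next
    show "polynomial_in X B c (\<lambda>s. \<Sum>d\<in>Basis. ((F s ^^ k) x \<bullet> d) * (F s d \<bullet> y))"
      by (intro polynomial_in_sum polynomial_in_mult Suc.IH assms(2))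
  qed
qed

section \<open>Behaviour under scaling and a nonzero value\<close>

lemma linear_half_trace: "linear half_trace"
  by (rule linearI)
     (simp_all add: half_trace_def blinfun.add_left blinfun.scaleR_left inner_add_left
       sum.distrib sum_distrib_left algebra_simps)

lemma linear_skew_part: "linear skew_part"
  by (rule linearI; rule blinfun_eqI)
     (simp_all add: skew_part_apply blinfun.add_left blinfun.add_right blinfun.scaleR_left
       blinfun.scaleR_right algebra_simps)

text \<open>The eigenspace of the scaled map for \<open>u\<close> is that of the original for
  \<open>u / t\<close>; positivity of \<open>t\<close> keeps the list nonnegative.\<close>

lemma skew_eigenvalues_scale:
  assumes "skew_eigenvalues A l" "0 < t"
  shows "skew_eigenvalues (t *\<^sub>R A) (\<lambda>i. t * l i)"
proof -
  have "(t *\<^sub>R w = u *\<^sub>R v) \<longleftrightarrow> w = (u / t) *\<^sub>R v" for w v :: "complex ^ 'a" and u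
    using assms(2) by (simp add: field_simps vector_fraction_eq_iff eq_vector_fraction_iff)
  moreover have "t * x = u \<longleftrightarrow> x = u / t" "- (t * x) = u \<longleftrightarrow> - x = u / t" for x u
    using assms(2) by (auto simp: field_simps)
  ultimately show ?thesis
    using assms unfolding skew_eigenvalues_def
    by (simp add: linear_scale[OF linear_skew_part] blinfun.scaleR_left)
qed

lemma M_Lag_scale:
  fixes A :: "(complex ^ 'n) \<Rightarrow>\<^sub>L (complex ^ 'n::finite)"
  assumes "A \<in> Sym2" "0 < t"
  shows "M_Lag (t *\<^sub>R A) = t ^ 2 ^ CARD('n) * M_Lag A"
proof -
  obtain l where l: "skew_eigenvalues A l" by (rule skew_eigenvalues_exist[OF assms(1)])
  have "M_Lag (t *\<^sub>R A) = sign_prod CARD('n) ((\<lambda>i. t * l i)(0 := half_trace (t *\<^sub>R A)))"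
    by (rule M_Lag_eq_sign_prod[OF skew_eigenvalues_scale[OF l assms(2)]])
  also have "\<dots> = sign_prod CARD('n) (\<lambda>i. t * (l(0 := half_trace A)) i)"
    by (rule sign_prod_cong) (simp add: linear_scale[OF linear_half_trace])
  finally show ?thesis by (simp only: sign_prod_scale M_Lag_eq_sign_prod[OF l])
qed

text \<open>Witnesses that the operator is not identically zero. The identity commutes with
  \<open>J\<close>, so its skew part vanishes and all entries of the list are 0, while half its
  trace is \<open>CARD('n)\<close>.\<close>

lemma M_Lag_id: "M_Lag (id_blinfun :: (complex ^ 'n) \<Rightarrow>\<^sub>L (complex ^ 'n::finite)) = CARD('n) ^ 2 ^ CARD('n)"
proof -
  let ?A = "id_blinfun :: (complex ^ 'n) \<Rightarrow>\<^sub>L (complex ^ 'n)"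
  \<comment> \<open>Eigenspaces of the zero map. At \<open>t = 0\<close> the full dimension matches
    because zero entries count twice.\<close>
  have "{v :: complex ^ 'n. 0 = t *\<^sub>R v} = (if t = 0 then UNIV else {0})" for t
    by auto
  moreover have "card {i. Suc 0 \<le> i \<and> i \<le> m} = m" for m
    using card_atLeastAtMost[of 1 m] by (simp add: atLeastAtMost_def atLeast_def atMost_def Int_def)
  ultimately have "skew_eigenvalues ?A (\<lambda>_. 0)"
    by (auto simp: skew_eigenvalues_def skew_part_apply cplx_J_cplx_J)
  from M_Lag_eq_sign_prod[OF this] show ?thesis
    by (simp add: sign_prod_def half_trace_def card_signs)
qed

text \<open>Single eigenvalues are in general not polynomial in \<open>A\<close>, but the power sums
  of their squares are, being half the traces of even powers of the skew part.\<close>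

lemma polynomial_in_M_Lag:
  fixes B :: "((complex ^ 'n) \<Rightarrow>\<^sub>L (complex ^ 'n::finite)) set"
  assumes B: "finite B" "independent B" "span B = Sym2"
    and q: "poly_vars q \<subseteq> {0..CARD('n)}"
      "\<And>x. sign_prod CARD('n) x = poly_eval q (\<lambda>i. (x i)\<^sup>2)"
  shows "polynomial_in Sym2 B (representation B) M_Lag"
proof -
  let ?I = "{1..CARD('n)}"
  have lin: "polynomial_in Sym2 B (representation B) h" if "linear h" for h
    using polynomial_in_linear[OF B(1,2) that] B(3) by simp
  let ?P = "\<lambda>(A :: (complex ^ 'n) \<Rightarrow>\<^sub>L (complex ^ 'n)) l. skew_eigenvalues A l \<and>
    (\<forall>k. (\<Sum>i\<in>?I. (l i)\<^sup>2 ^ k) =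
      (1/2) * (\<Sum>b\<in>Basis. (blinfun_apply (skew_part A) ^^ (2 * k)) b \<bullet> b))"
  \<comment> \<open>For each \<open>A\<close> one list is fixed that meets the eigenvalue and the
    trace conditions at once.\<close>
  define L where "L A = (SOME l. ?P A l)" for A
  have PL: "?P A (L A)" if A: "A \<in> Sym2" for A
  proof -
    obtain l where "?P A l" using skew_eigenvalues_exist[OF A] by blast
    then show ?thesis unfolding L_def by (rule someI[of "?P A"])
  qed
  have L: "skew_eigenvalues A (L A)" if "A \<in> Sym2" for A
    using PL[OF that] by (rule conjunct1)
  have trace: "(\<Sum>i\<in>?I. (L A i)\<^sup>2 ^ k) =
      (1/2) * (\<Sum>b\<in>Basis. (blinfun_apply (skew_part A) ^^ (2 * k)) b \<bullet> b)" if "A \<in> Sym2" for A k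
    using PL[OF that] by (elim conjE allE)
  show ?thesis
  proof (rule polynomial_in_power_sums[OF q(1)])
    show "polynomial_in Sym2 B (representation B) (\<lambda>A. (half_trace A)\<^sup>2)"
      by (intro polynomial_in_power lin linear_half_trace)
  next
    fix k
    have skew: "polynomial_in Sym2 B (representation B) (\<lambda>A. blinfun_apply (skew_part A) x \<bullet> y)" for x y
      by (rule lin, rule linearI)
         (simp_all add: linear_add[OF linear_skew_part] linear_scale[OF linear_skew_part]
           blinfun.add_left blinfun.scaleR_left inner_add_left)
    show "polynomial_in Sym2 B (representation B) (\<lambda>A. \<Sum>i\<in>?I. (L A i)\<^sup>2 ^ k)"
    proof (rule polynomial_in_cong[THEN iffD2], erule trace)
      show "polynomial_in Sym2 B (representation B)
          (\<lambda>A. (1/2) * (\<Sum>b\<in>Basis. (blinfun_apply (skew_part A) ^^ (2 * k)) b \<bullet> b))"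
        by (intro polynomial_in_mult polynomial_in_const polynomial_in_sum polynomial_in_funpow skew
            bounded_linear.linear[OF blinfun.bounded_linear_right])
    qed
  next
    \<comment> \<open>Reordering the list leaves the sign product unchanged, which is what averaging
      over injections requires.\<close>
    fix A :: "(complex ^ 'n) \<Rightarrow>\<^sub>L (complex ^ 'n)" and \<sigma>
    assume A: "A \<in> Sym2" and \<sigma>: "\<sigma> \<in> injections ?I ?I"
    let ?x = "\<lambda>i. if i = 0 then half_trace A else L A (\<sigma> i)"
    have \<sigma>I: "\<sigma> ` ?I \<subseteq> ?I" "inj_on \<sigma> ?I" using \<sigma> by (auto simp: injections_def)
    then have "bij_betw \<sigma> ?I ?I" by (simp add: bij_betw_def endo_inj_surj)
    then have "sign_prod CARD('n) ?x = sign_prod CARD('n) ((L A)(0 := half_trace A))"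
    proof (rule sign_prod_permute_tail)
      fix i assume i: "i \<in> ?I"
      then have "\<sigma> i \<noteq> 0" using \<sigma>I(1) by force
      then show "?x i = ((L A)(0 := half_trace A)) (\<sigma> i)" using i by simp
    qed simp
    also have "\<dots> = M_Lag A" using M_Lag_eq_sign_prod[OF L[OF A]] by simp
    finally have "M_Lag A = poly_eval q (\<lambda>i. (?x i)\<^sup>2)" by (simp only: q(2))
    also have "(\<lambda>i. (?x i)\<^sup>2) = (\<lambda>i. if i = 0 then (half_trace A)\<^sup>2 else (L A (\<sigma> i))\<^sup>2)"
      by auto
    finally show "M_Lag A = poly_eval q (\<lambda>i. if i = 0 then (half_trace A)\<^sup>2 else (L A (\<sigma> i))\<^sup>2)" .
  qed
qed

text \<open>Scaling \<open>A\<close> scales its coordinates, so homogeneity of the operator together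
  with one nonzero value fixes the exact degree.\<close>

lemma polynomial_of_degree_on_M_Lag:
  fixes q :: "nat rpoly"
  assumes q: "poly_vars q \<subseteq> {0..CARD('n::finite)}"
      "\<And>x. sign_prod CARD('n) x = poly_eval q (\<lambda>i. (x i)\<^sup>2)"
  shows "polynomial_of_degree_on Sym2
    (M_Lag :: ((complex ^ 'n) \<Rightarrow>\<^sub>L (complex ^ 'n)) \<Rightarrow> real) (2 ^ CARD('n))"
proof -
  obtain B :: "((complex ^ 'n) \<Rightarrow>\<^sub>L (complex ^ 'n)) set"
    where B: "finite B" "independent B" "span B = Sym2"
    using finite_basis_blinfun[OF subspace_Sym2] by blast
  obtain p where "poly_vars p \<subseteq> B" "total_degree p = 2 ^ CARD('n)"
    "\<And>A. A \<in> Sym2 \<Longrightarrow> M_Lag A = poly_eval p (representation B A)"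
  proof (rule polynomial_in_homogeneous[OF polynomial_in_M_Lag[OF B q], where N = "2 ^ CARD('n)"])
    fix A :: "(complex ^ 'n) \<Rightarrow>\<^sub>L (complex ^ 'n)" and t :: real
    assume A: "A \<in> Sym2" and t: "0 < t"
    have "representation B (t *\<^sub>R A) = (\<lambda>v. t * representation B A v)"
      using A B by (simp add: real_vector.representation_scale)
    then show "\<exists>A'\<in>Sym2. representation B A' = (\<lambda>v. t * representation B A v) \<and>
        M_Lag A' = t ^ 2 ^ CARD('n) * M_Lag A"
      using M_Lag_scale[OF A t] subspace_scale[OF subspace_Sym2 A] by blast
  next
    have "id_blinfun \<in> (Sym2 :: ((complex ^ 'n) \<Rightarrow>\<^sub>L (complex ^ 'n)) set)"
      by (simp add: Sym2_def)
    then show "\<exists>A\<in>(Sym2 :: ((complex ^ 'n) \<Rightarrow>\<^sub>L (complex ^ 'n)) set). M_Lag A \<noteq> 0"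
      by (rule bexI[rotated]) (simp add: M_Lag_id)
  qed blast
  then show ?thesis using B unfolding polynomial_of_degree_on_def by blast
qed

theorem proposition5p2:
  assumes "2 \<le> CARD('n::finite)"
  shows "polynomial_of_degree_on Sym2
           (M_Lag :: ((complex ^ 'n) \<Rightarrow>\<^sub>L (complex ^ 'n)) \<Rightarrow> real) (2 ^ CARD('n)) \<and>
         (\<exists>q :: nat rpoly.
            symmetric_poly_in {0..CARD('n)} q \<and>
            total_degree q = 2 ^ (CARD('n) - 1) \<and>
            (\<forall>(A :: (complex ^ 'n) \<Rightarrow>\<^sub>L (complex ^ 'n)) \<in> Sym2. \<forall>l. skew_eigenvalues A l \<longrightarrow>
               M_Lag A = poly_eval q (\<lambda>i. ((l(0 := half_trace A)) i)\<^sup>2)))"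
proof -
  obtain q :: "nat rpoly" where q: "symmetric_poly_in {0..CARD('n)} q"
    "total_degree q = 2 ^ (CARD('n) - 1)"
    "\<And>x. sign_prod CARD('n) x = poly_eval q (\<lambda>i. (x i)\<^sup>2)"
    using sign_prod_symmetric_polynomial_in_squares[OF assms] by blast
  have "polynomial_of_degree_on Sym2
      (M_Lag :: ((complex ^ 'n) \<Rightarrow>\<^sub>L (complex ^ 'n)) \<Rightarrow> real) (2 ^ CARD('n))"
    by (rule polynomial_of_degree_on_M_Lag[OF _ q(3)])
       (use q(1) in \<open>simp add: symmetric_poly_in_def\<close>)
  \<comment> \<open>\<open>q\<close> represents the sign product itself, so it applies to every
    admissible list at once.\<close>
  moreover have "M_Lag A = poly_eval q (\<lambda>i. ((l(0 := half_trace A)) i)\<^sup>2)"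
    if "skew_eigenvalues A l" for A :: "(complex ^ 'n) \<Rightarrow>\<^sub>L (complex ^ 'n)" and l
    using M_Lag_eq_sign_prod[OF that] q(3) by simp
  ultimately show ?thesis using q(1,2) by blast
qed

end
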